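(* For $\sigma>1/2$, assume the zero density hypothesis $$N(\sigma,T)\ll T^{2(1-\sigma)}(\log T)^{-B}$$ with $B>4$. Then there is a constant $\lambda$ such that the gap between the imaginary parts of consecutive zeros of the Riemann zeta function is smaller than $\lambda$ times the average gap, infinitely often.
   Context: $N(\sigma,T)=\#\{\rho:\zeta(\rho)=0,\ \mathrm{Re}(\rho)>\sigma,\ |\mathrm{Im}(\rho)|<T\}$, where $\zeta$ is the Riemann zeta function. The average gap between the ordinates of non-trivial zeros near height $\gamma$ is $2\pi/\log\gamma$. The statement places no explicit bound on $\lambda$. *)

theory Defs
  imports "HOL-Complex_Analysis.Complex_Analysis" "HOL-Library.Landau_Symbols"
begin

text \<open>Existence and uniqueness of the analytic continuation of \<open>\<Sum>n\<ge>1. n powr -s\<close> to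
  \<open>s \<noteq> 1\<close>. The half-plane of definition is enlarged step by step by expanding
  \<open>(n + 1) powr (1 - s) - n powr (1 - s)\<close> into a Taylor polynomial plus remainder and summing over \<open>n\<close>.\<close>

lemma holomorphic_series:
  fixes f :: "nat \<Rightarrow> complex \<Rightarrow> complex"
  assumes S: "open S" and hol: "\<And>n. f n holomorphic_on S"
    and bnd: "\<And>x. x \<in> S \<Longrightarrow> \<exists>d h. 0 < d \<and> summable h \<and> (\<forall>n. \<forall>y\<in>ball x d \<inter> S. norm (f n y) \<le> h n)"
  shows "(\<lambda>z. \<Sum>n. f n z) holomorphic_on S" and "\<And>z. z \<in> S \<Longrightarrow> summable (\<lambda>n. f n z)"
proof -
  have "\<exists>g g'. \<forall>x \<in> S. ((\<lambda>n. f n x) sums g x) \<and> ((\<lambda>n. deriv (f n) x) sums g' x)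
      \<and> (g has_field_derivative g' x) (at x)"
  proof (rule series_and_derivative_comparison_local[OF S])
    show "(f n has_field_derivative deriv (f n) x) (at x)" if "x \<in> S" for n x
      using hol S that by (rule holomorphic_derivI)
    show "\<exists>d h. 0 < d \<and> summable h \<and> (\<forall>\<^sub>F n in sequentially. \<forall>y\<in>ball x d \<inter> S. norm (f n y) \<le> h n)"
      if "x \<in> S" for x
    proof -
      obtain d h where "0 < d" "summable h" "\<forall>n. \<forall>y\<in>ball x d \<inter> S. norm (f n y) \<le> h n"
        using bnd[OF \<open>x \<in> S\<close>] by blast
      then show ?thesis by (intro exI[of _ d] exI[of _ h]) auto
    qed
  qed
  then obtain g g' where g: "\<And>x. x \<in> S \<Longrightarrow> (\<lambda>n. f n x) sums g x"
    "\<And>x. x \<in> S \<Longrightarrow> (g has_field_derivative g' x) (at x)" by blast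
  have "g holomorphic_on S"
    using g(2) S holomorphic_on_open by blast
  then show "(\<lambda>z. \<Sum>n. f n z) holomorphic_on S"
    by (rule holomorphic_transform) (use g(1) sums_unique in blast)
  show "\<And>z. z \<in> S \<Longrightarrow> summable (\<lambda>n. f n z)"
    using g(1) sums_summable by blast
qed

lemma summable_Suc_powr:
  assumes "a < -1" shows "summable (\<lambda>n. real (Suc n) powr a)"
  using assms by (subst summable_Suc_iff) (simp add: summable_real_powr_iff)

lemma norm_Suc_powr: "norm (of_nat (Suc n) powr s :: complex) = real (Suc n) powr Re s"
  by (subst norm_powr_real_powr) auto

definition falling :: "nat \<Rightarrow> complex \<Rightarrow> complex" where
  "falling k w = (\<Prod>j<k. w - of_nat j)"

definition powr_remainder :: "nat \<Rightarrow> nat \<Rightarrow> complex \<Rightarrow> complex" where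
  "powr_remainder K n s = of_nat (Suc (Suc n)) powr (1 - s)
     - (\<Sum>i\<le>Suc K. falling i (1 - s) * of_nat (Suc n) powr (1 - s - of_nat i) / fact i)"

lemma holomorphic_falling [holomorphic_intros]:
  "f holomorphic_on A \<Longrightarrow> (\<lambda>s. falling k (f s)) holomorphic_on A"
  unfolding falling_def by (intro holomorphic_intros)

lemma holomorphic_powr_remainder: "powr_remainder K n holomorphic_on A"
  unfolding powr_remainder_def by (intro holomorphic_intros) auto

lemma norm_powr_remainder_le:
  assumes "Re s > - real K"
  shows "norm (powr_remainder K n s) \<le>
    norm (falling (K + 2) (1 - s)) * real (Suc n) powr (-1 - (Re s + real K))"
proof -
  define S where "S = closed_segment (of_nat (Suc n) :: complex) (of_nat (Suc (Suc n)))"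
  define f where "f = (\<lambda>i x. falling i (1 - s) * x powr (1 - s - of_nat i))"
  define B where "B = norm (falling (K + 2) (1 - s)) * real (Suc n) powr (-1 - (Re s + real K))"
  have S_real: "\<exists>y. x = of_real y \<and> real (Suc n) \<le> y" if "x \<in> S" for x
  proof -
    have "x \<in> closed_segment (of_real (real (Suc n))) (of_real (real (Suc (Suc n))))"
      using that unfolding S_def of_real_of_nat_eq .
    then have "x \<in> of_real ` closed_segment (real (Suc n)) (real (Suc (Suc n)))"
      by (simp only: closed_segment_of_real)
    then show ?thesis
      by (auto simp: closed_segment_eq_real_ivl)
  qed
  have der: "(f i has_field_derivative f (Suc i) x) (at x within S)" if "x \<in> S" for i x
  proof -
    obtain y where y: "x = of_real y" "real (Suc n) \<le> y" using S_real[OF \<open>x \<in> S\<close>] by blast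
    then have "x \<notin> \<real>\<^sub>\<le>\<^sub>0" by auto
    then show ?thesis
      unfolding f_def
      by (auto intro!: derivative_eq_intros simp: falling_def algebra_simps)
  qed
  have bnd: "norm (f (Suc (Suc K)) x) \<le> B" if "x \<in> S" for x
  proof -
    obtain y where y: "x = of_real y" "real (Suc n) \<le> y" using S_real[OF \<open>x \<in> S\<close>] by blast
    have "norm (x powr (1 - s - of_nat (Suc (Suc K)))) = y powr (-1 - (Re s + real K))"
      using y by (subst norm_powr_real_powr) (auto simp: algebra_simps)
    also have "\<dots> \<le> real (Suc n) powr (-1 - (Re s + real K))"
      using y assms by (intro powr_mono2') auto
    finally show ?thesis
      unfolding f_def B_def by (auto simp: norm_mult intro!: mult_left_mono)
  qed
  have "norm (f 0 (of_nat (Suc (Suc n))) - (\<Sum>i\<le>Suc K. f i (of_nat (Suc n)) *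
      (of_nat (Suc (Suc n)) - of_nat (Suc n)) ^ i / fact i))
      \<le> B * norm (of_nat (Suc (Suc n)) - of_nat (Suc n) :: complex) ^ Suc (Suc K) / fact (Suc K)"
    by (rule complex_Taylor[of S]) (use der bnd in \<open>auto simp: S_def simp del: of_nat_Suc\<close>)
  also have "of_nat (Suc (Suc n)) - of_nat (Suc n) = (1::complex)" by simp
  also have "B * norm (1::complex) ^ Suc (Suc K) / fact (Suc K) \<le> B"
  proof -
    have "B \<ge> 0" unfolding B_def by simp
    then have "B / fact (Suc K) \<le> B / 1"
      by (intro divide_left_mono) (auto simp: fact_ge_1 simp del: fact_Suc)
    then show ?thesis by simp
  qed
  finally show ?thesis
    unfolding powr_remainder_def f_def B_def by (simp add: falling_def del: of_nat_Suc)
qed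

lemma powr_remainder_series:
  fixes K :: nat
  defines "S \<equiv> {s. Re s > - real K}"
  shows "(\<lambda>s. \<Sum>n. powr_remainder K n s) holomorphic_on S"
    and "\<And>s. s \<in> S \<Longrightarrow> summable (\<lambda>n. powr_remainder K n s)"
proof -
  have opn: "open S" unfolding S_def by (rule open_halfspace_Re_gt)
  have bnd: "\<exists>d h. 0 < d \<and> summable h \<and> (\<forall>n. \<forall>y\<in>ball x d \<inter> S. norm (powr_remainder K n y) \<le> h n)"
    if "x \<in> S" for x
  proof -
    define d where "d = (Re x + real K) / 2"
    have d: "d > 0" using that unfolding d_def S_def by simp
    have "compact ((\<lambda>y. falling (K + 2) (1 - y)) ` cball x d)"
      by (intro compact_continuous_image holomorphic_on_imp_continuous_on holomorphic_intros) auto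
    then obtain M where M: "\<And>y. y \<in> cball x d \<Longrightarrow> norm (falling (K + 2) (1 - y)) \<le> M"
      using compact_imp_bounded bounded_iff by (metis image_eqI)
    have "norm (powr_remainder K n y) \<le> M * real (Suc n) powr (-1 - d)" if y: "y \<in> ball x d \<inter> S" for n y
    proof -
      have "\<bar>Re (x - y)\<bar> \<le> norm (x - y)" by (rule abs_Re_le_cmod)
      also have "\<dots> < d" using y by (simp add: dist_norm)
      finally have "Re x - Re y < d" by simp
      then have "Re y + real K \<ge> d" unfolding d_def by (simp add: field_simps)
      then have "real (Suc n) powr (-1 - (Re y + real K)) \<le> real (Suc n) powr (-1 - d)"
        by (intro powr_mono) auto
      moreover have "norm (falling (K + 2) (1 - y)) \<le> M" using y M by auto
      ultimately have "norm (falling (K + 2) (1 - y)) * real (Suc n) powr (-1 - (Re y + real K))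
          \<le> M * real (Suc n) powr (-1 - d)"
        by (intro mult_mono) (auto intro: order_trans[OF norm_ge_zero])
      with norm_powr_remainder_le[of K y n] y show ?thesis unfolding S_def by auto
    qed
    moreover have "summable (\<lambda>n. M * real (Suc n) powr (-1 - d))"
      using d by (intro summable_mult summable_Suc_powr) auto
    ultimately show ?thesis using d by blast
  qed
  show "(\<lambda>s. \<Sum>n. powr_remainder K n s) holomorphic_on S"
    by (rule holomorphic_series(1)[OF opn holomorphic_powr_remainder bnd])
  show "\<And>s. s \<in> S \<Longrightarrow> summable (\<lambda>n. powr_remainder K n s)"
    by (rule holomorphic_series(2)[OF opn holomorphic_powr_remainder bnd])
qed

definition zeta_series :: "complex \<Rightarrow> complex" where
  "zeta_series s = (\<Sum>n. of_nat (Suc n) powr - s)"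

lemma zeta_series_sums:
  assumes "Re s > 1" shows "(\<lambda>n. of_nat (Suc n) powr - s) sums zeta_series s"
proof -
  have "summable (\<lambda>n. norm (of_nat (Suc n) powr - s))"
    unfolding norm_Suc_powr using assms by (intro summable_Suc_powr) auto
  then show ?thesis
    unfolding zeta_series_def by (rule summable_sums[OF summable_norm_cancel])
qed

lemma zeta_series_holomorphic: "zeta_series holomorphic_on {s. Re s > 1}"
proof -
  have "(\<lambda>s. \<Sum>n. of_nat (Suc n) powr - s :: complex) holomorphic_on {s. Re s > 1}"
  proof (rule holomorphic_series(1))
    show "open {s. Re s > 1}" by (rule open_halfspace_Re_gt)
    show "(\<lambda>s. of_nat (Suc n) powr - s) holomorphic_on {s. Re s > 1}" for n
      by (intro holomorphic_intros)
    fix x assume x: "x \<in> {s. Re s > 1}"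
    define d where "d = (Re x - 1) / 2"
    have d: "d > 0" using x unfolding d_def by simp
    have "norm (of_nat (Suc n) powr - y :: complex) \<le> real (Suc n) powr (-1 - d)"
      if y: "y \<in> ball x d \<inter> {s. Re s > 1}" for n y
    proof -
      have "\<bar>Re (x - y)\<bar> \<le> norm (x - y)" by (rule abs_Re_le_cmod)
      also have "\<dots> < d" using y by (simp add: dist_norm)
      finally have "Re x - Re y < d" by simp
      then have "Re y \<ge> 1 + d" unfolding d_def by (simp add: field_simps)
      then show ?thesis
        unfolding norm_Suc_powr by (intro powr_mono) auto
    qed
    moreover have "summable (\<lambda>n. real (Suc n) powr (-1 - d))"
      using d by (intro summable_Suc_powr) auto
    ultimately show "\<exists>d h. 0 < d \<and> summable h \<and>
        (\<forall>n. \<forall>y\<in>ball x d \<inter> {s. Re s > 1}. norm (of_nat (Suc n) powr - y :: complex) \<le> h n)"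
      using d by blast
  qed
  then show ?thesis unfolding zeta_series_def[abs_def] .
qed

lemma zeta_series_recurrence:
  assumes s: "Re s > 1"
  shows "(s - 1) * zeta_series s = 1 + (\<Sum>n. powr_remainder K n s)
    - (\<Sum>i=2..Suc K. falling (i - 1) (1 - s) / fact i * ((s + of_nat i - 2) * zeta_series (s + of_nat i - 1)))"
proof -
  define a where "a = (\<lambda>n. of_nat (Suc n) powr (1 - s) :: complex)"
  define P where "P = (\<lambda>n i. falling i (1 - s) * of_nat (Suc n) powr (1 - s - of_nat i) / fact i :: complex)"
  have "(\<lambda>n. norm (a n)) \<longlonglongrightarrow> 0"
  proof -
    have "(\<lambda>n. real n powr (1 - Re s)) \<longlonglongrightarrow> 0"
      using s by (intro tendsto_neg_powr filterlim_real_sequentially) auto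
    from LIMSEQ_Suc[OF this] show ?thesis unfolding a_def norm_Suc_powr by simp
  qed
  then have "a \<longlonglongrightarrow> 0" by (rule tendsto_norm_zero_cancel)
  from telescope_sums[OF this] have tel: "(\<lambda>n. a (Suc n) - a n) sums (- 1)"
    unfolding a_def by simp
  have R: "(\<lambda>n. powr_remainder K n s) sums (\<Sum>n. powr_remainder K n s)"
    using powr_remainder_series(2)[of s K] s by (intro summable_sums) auto
  have "(\<lambda>n. P n i) sums (falling i (1 - s) / fact i * zeta_series (s + of_nat i - 1))"
    if "i \<ge> 1" for i
  proof -
    have "Re (s + of_nat i - 1) > 1" using s that by simp
    from sums_mult[OF zeta_series_sums[OF this], of "falling i (1 - s) / fact i"] show ?thesis
      unfolding P_def by (simp add: algebra_simps)
  qed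
  then have Ps: "(\<lambda>n. \<Sum>i=1..Suc K. P n i) sums
      (\<Sum>i=1..Suc K. falling i (1 - s) / fact i * zeta_series (s + of_nat i - 1))"
    by (intro sums_sum) auto
  have step: "a (Suc n) - a n = powr_remainder K n s + (\<Sum>i=1..Suc K. P n i)" for n
  proof -
    have "(\<Sum>i\<le>Suc K. P n i) = P n 0 + (\<Sum>i=1..Suc K. P n i)"
      unfolding atMost_atLeast0 by (subst sum.atLeast_Suc_atMost) auto
    moreover have "P n 0 = a n" unfolding P_def a_def falling_def by simp
    moreover have "powr_remainder K n s = a (Suc n) - (\<Sum>i\<le>Suc K. P n i)"
      unfolding powr_remainder_def P_def a_def by simp
    ultimately show ?thesis by simp
  qed
  have
    "- 1 = (\<Sum>n. powr_remainder K n s) +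
      (\<Sum>i=1..Suc K. falling i (1 - s) / fact i * zeta_series (s + of_nat i - 1))"
    using tel sums_add[OF R Ps] unfolding step by (rule sums_unique2)
  also have "(\<Sum>i=1..Suc K. falling i (1 - s) / fact i * zeta_series (s + of_nat i - 1)) =
    (1 - s) * zeta_series s + (\<Sum>i=2..Suc K. falling i (1 - s) / fact i * zeta_series (s + of_nat i - 1))"
    by (subst sum.atLeast_Suc_atMost) (auto simp: falling_def numeral_2_eq_2)
  also have "(\<Sum>i=2..Suc K. falling i (1 - s) / fact i * zeta_series (s + of_nat i - 1)) =
    - (\<Sum>i=2..Suc K. falling (i - 1) (1 - s) / fact i * ((s + of_nat i - 2) * zeta_series (s + of_nat i - 1)))"
    unfolding sum_negf[symmetric]
  proof (rule sum.cong)
    fix i assume "i \<in> {2..Suc K}"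
    then obtain j where j: "i = Suc j" by (cases i) auto
    show "falling i (1 - s) / fact i * zeta_series (s + of_nat i - 1) =
      - (falling (i - 1) (1 - s) / fact i * ((s + of_nat i - 2) * zeta_series (s + of_nat i - 1)))"
    proof -
      have "falling i (1 - s) = - (falling (i - 1) (1 - s) * (s + of_nat i - 2))"
        unfolding j by (simp add: falling_def algebra_simps)
      then show ?thesis by simp
    qed
  qed simp
  finally have eq: "- 1 = (\<Sum>n. powr_remainder K n s) + ((1 - s) * zeta_series s +
    - (\<Sum>i=2..Suc K. falling (i - 1) (1 - s) / fact i * ((s + of_nat i - 2) * zeta_series (s + of_nat i - 1))))" .
  have "(s - 1) * z = 1 + R - X" if "- 1 = R + ((1 - s) * z + - X)" for z R X :: complex
  proof -
    have "(1 - s) * z = (R + ((1 - s) * z + - X)) - R + X" by simp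
    also have "\<dots> = - 1 - R + X" using that by simp
    finally have "- ((1 - s) * z) = - (- 1 - R + X)" by (rule arg_cong)
    also have "- ((1 - s) * z) = (s - 1) * z" by (simp add: algebra_simps)
    also have "- (- 1 - R + X) = 1 + R - X" by simp
    finally show ?thesis .
  qed
  from this[OF eq] show ?thesis .
qed

lemma zeta_continuation_halfplane:
  "\<exists>g. g holomorphic_on {s. Re s > 1 - real K} \<and> (\<forall>s. Re s > 1 \<longrightarrow> g s = (s - 1) * zeta_series s)"
proof (induction K)
  case 0
  show ?case
    by (rule exI[of _ "\<lambda>s. (s - 1) * zeta_series s"])
       (auto intro!: holomorphic_intros zeta_series_holomorphic)
next
  case (Suc K)
  then obtain g where g: "g holomorphic_on {s. Re s > 1 - real K}"
    "\<And>s. Re s > 1 \<Longrightarrow> g s = (s - 1) * zeta_series s" by blast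
  define g' where "g' = (\<lambda>s. 1 + (\<Sum>n. powr_remainder K n s)
    - (\<Sum>i=2..Suc K. falling (i - 1) (1 - s) / fact i * g (s + of_nat i - 1)))"
  have "(\<lambda>s. g (s + of_nat i - 1)) holomorphic_on {s. Re s > - real K}" if "i \<ge> 2" for i
  proof -
    have "(g \<circ> (\<lambda>s. s + of_nat i - 1)) holomorphic_on {s. Re s > - real K}"
      using that by (intro holomorphic_on_compose_gen[OF _ g(1)] holomorphic_intros) auto
    then show ?thesis by (simp add: o_def)
  qed
  then have "g' holomorphic_on {s. Re s > - real K}"
    unfolding g'_def by (intro holomorphic_intros powr_remainder_series(1)) auto
  moreover have "g' s = (s - 1) * zeta_series s" if "Re s > 1" for s
  proof -
    have "g (s + of_nat i - 1) = (s + of_nat i - 2) * zeta_series (s + of_nat i - 1)" if "i \<ge> 2" for i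
      using g(2)[of "s + of_nat i - 1"] that \<open>Re s > 1\<close> by (simp add: algebra_simps)
    then show ?thesis
      unfolding zeta_series_recurrence[OF that, of K] g'_def by (intro arg_cong2[of _ _ _ _ "(-)"] sum.cong) auto
  qed
  ultimately show ?case by (intro exI[of _ g']) (auto simp: algebra_simps)
qed

lemma zeta_continuation_entire:
  "\<exists>g. g holomorphic_on UNIV \<and> (\<forall>s. Re s > 1 \<longrightarrow> g s = (s - 1) * zeta_series s)"
proof -
  obtain G where G: "\<And>K. G K holomorphic_on {s. Re s > 1 - real K}"
    "\<And>K s. Re s > 1 \<Longrightarrow> G K s = (s - 1) * zeta_series s"
    using zeta_continuation_halfplane by metis
  have agree: "G K s = G L s" if "K \<le> L" "Re s > 1 - real K" for K L s
  proof (rule analytic_continuation_open[of "{s. Re s > 1}" "{s. Re s > 1 - real K}" "G K" "G L"])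
    have "Re 2 > 1" by simp
    then show "{s. Re s > 1} \<noteq> {}" by blast
    show "connected {s. Re s > 1 - real K}"
      by (intro convex_connected convex_halfspace_Re_gt)
    show "G L holomorphic_on {s. Re s > 1 - real K}"
      by (rule holomorphic_on_subset[OF G(1)]) (use that in auto)
  qed (use that G in \<open>auto simp: open_halfspace_Re_gt\<close>)
  define k where "k = (\<lambda>s. nat \<lceil>2 - Re s\<rceil>)"
  have k: "Re s > 1 - real (k s)" for s unfolding k_def by linarith
  define g where "g = (\<lambda>s. G (k s) s)"
  have gG: "g s = G K s" if "Re s > 1 - real K" for K s
    unfolding g_def using agree[of K "k s" s] agree[of "k s" K s] that k[of s] by (metis nat_le_linear)
  have "g field_differentiable at s" for s
  proof -
    have op: "open {z. Re z > 1 - real (k s)}" by (rule open_halfspace_Re_gt)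
    have "g holomorphic_on {z. Re z > 1 - real (k s)}"
      by (rule holomorphic_transform[OF G(1)[of "k s"]]) (simp add: gG)
    then show ?thesis using op k[of s] holomorphic_on_imp_differentiable_at by blast
  qed
  then have "g holomorphic_on UNIV" by (simp add: holomorphic_on_def field_differentiable_at_within)
  moreover have "g s = (s - 1) * zeta_series s" if "Re s > 1" for s
    unfolding g_def using G(2) that by blast
  ultimately show ?thesis by blast
qed

text \<open>The value at the pole \<open>s = 1\<close> is arbitrary; it is fixed to be \<open>0\<close> only to make the
  description definite.\<close>

definition zeta :: "complex \<Rightarrow> complex" where
  "zeta = (THE f. f holomorphic_on - {1} \<and>
     (\<forall>s. Re s > 1 \<longrightarrow> (\<lambda>n. of_nat (Suc n) powr - s) sums f s) \<and> f 1 = 0)"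

lemma zeta_ex1:
  "\<exists>!f. f holomorphic_on - {1} \<and>
     (\<forall>s. Re s > 1 \<longrightarrow> (\<lambda>n. of_nat (Suc n) powr - s) sums f s) \<and> f (1::complex) = 0"
proof -
  obtain g where g: "g holomorphic_on UNIV" "\<And>s. Re s > 1 \<Longrightarrow> g s = (s - 1) * zeta_series s"
    using zeta_continuation_entire by blast
  show ?thesis
  proof (rule ex1I)
    show "(\<lambda>s. g s / (s - 1)) holomorphic_on - {1} \<and>
     (\<forall>s. Re s > 1 \<longrightarrow> (\<lambda>n. of_nat (Suc n) powr - s) sums (g s / (s - 1))) \<and> g 1 / (1 - 1) = 0"
    proof (intro conjI allI impI)
      show "(\<lambda>s. g s / (s - 1)) holomorphic_on - {1}"
        by (intro holomorphic_intros holomorphic_on_subset[OF g(1)]) auto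
      fix s :: complex assume s: "Re s > 1"
      then have "s \<noteq> 1" by auto
      then have "g s / (s - 1) = zeta_series s" using g(2)[OF s] by simp
      then show "(\<lambda>n. of_nat (Suc n) powr - s) sums (g s / (s - 1))"
        using zeta_series_sums[OF s] by simp
    qed simp
  next
    fix f :: "complex \<Rightarrow> complex"
    assume f: "f holomorphic_on - {1} \<and>
     (\<forall>s. Re s > 1 \<longrightarrow> (\<lambda>n. of_nat (Suc n) powr - s) sums f s) \<and> f 1 = 0"
    show "f = (\<lambda>s. g s / (s - 1))"
    proof
      fix s :: complex
      show "f s = g s / (s - 1)"
      proof (cases "s = 1")
        case False
        show ?thesis
        proof (rule analytic_continuation_open[of "{s. Re s > 1}" "- {1}" f])
          have "Re 2 > 1" by simp
          then show "{s. Re s > 1} \<noteq> {}" by blast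
          show "connected (- {1::complex})"
            by (rule connected_punctured_universe) auto
          show "(\<lambda>s. g s / (s - 1)) holomorphic_on - {1}"
            by (intro holomorphic_intros holomorphic_on_subset[OF g(1)]) auto
          fix z assume z: "z \<in> {s. Re s > 1}"
          then have "f z = zeta_series z"
            using f zeta_series_sums sums_unique2 by blast
          moreover have "z \<noteq> 1" using z by auto
          ultimately show "f z = g z / (z - 1)" using g(2) z by simp
        qed (use f False in \<open>auto simp: open_halfspace_Re_gt\<close>)
      qed (use f in simp)
    qed
  qed
qed

lemma zeta_holomorphic: "zeta holomorphic_on - {1}"
  and zeta_sums: "Re s > 1 \<Longrightarrow> (\<lambda>n. of_nat (Suc n) powr - s) sums zeta s"
  using theI'[OF zeta_ex1] unfolding zeta_def[symmetric] by auto

definition zero_density :: "real \<Rightarrow> real \<Rightarrow> nat" where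
  "zero_density \<sigma> T = card {\<rho>. \<rho> \<noteq> 1 \<and> zeta \<rho> = 0 \<and> Re \<rho> > \<sigma> \<and> \<bar>Im \<rho>\<bar> < T}"

definition nontrivial_zeros :: "complex set" where
  "nontrivial_zeros = {\<rho>. zeta \<rho> = 0 \<and> 0 < Re \<rho> \<and> Re \<rho> < 1}"

definition zero_count :: "real \<Rightarrow> nat" where
  "zero_count T = (\<Sum>\<rho> \<in> {\<rho> \<in> nontrivial_zeros. 0 < Im \<rho> \<and> Im \<rho> \<le> T}. nat (zorder zeta \<rho>))"

text \<open>The sequence \<open>0 < \<gamma>\<^sub>0 \<le> \<gamma>\<^sub>1 \<le> \<dots>\<close> of ordinates of the nontrivial zeros in the upper
  half-plane, each zero being repeated according to its multiplicity. This is the counting for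
  which the average gap at height \<open>\<gamma>\<close> is \<open>2 * pi / ln \<gamma>\<close>.\<close>

definition ordinate :: "nat \<Rightarrow> real" where
  "ordinate n = Inf {T. zero_count T > n}"

definition average_gap :: "real \<Rightarrow> real" where
  "average_gap \<gamma> = 2 * pi / ln \<gamma>"

end

theory Submission
  imports Defs "HOL-Real_Asymp.Real_Asymp"
begin

text \<open>Since \<open>lam\<close> is unrestricted, it suffices to refute that the normalized gaps tend to infinity. If they
  did, every window of bounded height near \<open>T\<close> would contain only \<open>o(ln T)\<close> zeros. The density
  hypothesis gives arbitrarily large \<open>T\<close> such that no zero near height \<open>T\<close> has real part \<open>> 9/10\<close>,
  hence, by the functional equation, none has real part \<open>< 1/10\<close>. Divide \<open>zeta\<close> by its \<open>o(ln T)\<close> zeros in a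
  disc around \<open>3 + \<i> T\<close> that reaches beyond the critical strip, take a logarithm, divide it by \<open>ln T\<close>
  and exponentiate: these functions form a normal family, and any limit has modulus \<open>1\<close> near the
  centre, so it is constant. But the functional equation gives
  \<open>\<bar>zeta (-1/2 + \<i> T)\<bar> = \<bar>-1/2 + \<i> T\<bar> / (2 * pi) * \<bar>zeta (3/2 + \<i> T)\<bar>\<close>,
  which makes the limit grow by a factor of at least \<open>exp 1\<close>.

  The functional equation is obtained for \<open>-1 < s < 0\<close> by computing the Mellin transform of
  \<open>1 / (exp x - 1) - 1 / x + 1 / 2\<close> in two ways: from its partial fraction expansion, and from its
  expansion as a sum of Laplace transforms of the Euler--Maclaurin kernel.\<close>

section \<open>Euler--Maclaurin summation for zeta\<close>

text \<open>Everything left of the critical strip happens in Re s > -1: the polynomial bound on the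
  rim of the disc and the value at -1/2 + \<i> T. The line Re s = -1/2 is chosen because there -s is
  the conjugate of s + 1, so the reflection formula gives the modulus of the Gamma factor exactly.
  The factor \<open>T / (2 * pi)\<close>, raised to the power \<open>1 / ln T\<close>, tends to
  \<open>exp 1\<close>.

  The obstacle is that \<open>zero_count\<close> sees only zeros with 0 < Re s < 1, while every zero
  in the disc must be divided out, at a total cost of exp(o(ln T)). Windows without zeros of real
  part above 9/10, together with reflection, confine the zeros to 1/10 \<le> Re s \<le> 9/10; then
  all of them are counted, and points with Re s \<ge> 1 keep a distance of 1/10 from them. Such
  windows exist because the exponent 2 (1 - 9/10) = 1/5 is below 1, while a zero in every window
  would mean linear growth.

  The Mellin kernel is of order x at 0 and tends to 1/2 at infinity, whence the range -1 < s < 0.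
  Both of its expansions have nonnegative terms, so sums and integrals are exchanged in the extended
  nonnegative reals.\<close>

lemma integral_parabola_second_deriv:
  fixes g g' g'' G :: "real \<Rightarrow> 'a::banach" and a :: real
  assumes cont: "continuous_on {a..a + 1} (\<lambda>u. ((u - a) * (a + 1 - u) / 2) *\<^sub>R g' u)"
      "continuous_on {a..a + 1} g" "continuous_on {a..a + 1} G"
    and g: "\<And>u. u \<in> {a<..<a + 1} \<Longrightarrow> (g has_vector_derivative g' u) (at u)"
    and g': "\<And>u. u \<in> {a<..<a + 1} \<Longrightarrow> (g' has_vector_derivative g'' u) (at u)"
    and G: "\<And>u. u \<in> {a<..<a + 1} \<Longrightarrow> (G has_vector_derivative g u) (at u)"
  shows "((\<lambda>u. ((u - a) * (a + 1 - u) / 2) *\<^sub>R g'' u) has_integral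
      ((1 / 2) *\<^sub>R (g a + g (a + 1)) - (G (a + 1) - G a))) {a..a + 1}"
proof -
  \<comment> \<open>Two integrations by parts in one antiderivative: the parabola has derivative
    \<open>a + 1 / 2 - u\<close>, whose own derivative is -1. The parabola vanishes at both ends, so
    only \<open>g\<close> and \<open>G\<close> survive there; what remains is the error of the
    trapezoidal rule for \<open>g\<close>.\<close>
  define F where "F = (\<lambda>u. ((u - a) * (a + 1 - u) / 2) *\<^sub>R g' u - (a + 1 / 2 - u) *\<^sub>R g u - G u)"
  have "((\<lambda>u. ((u - a) * (a + 1 - u) / 2) *\<^sub>R g'' u) has_integral (F (a + 1) - F a)) {a..a + 1}"
  proof (rule fundamental_theorem_of_calculus_interior)
    show "continuous_on {a..a + 1} F"
      unfolding F_def by (intro continuous_intros cont)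
    show "(F has_vector_derivative ((u - a) * (a + 1 - u) / 2) *\<^sub>R g'' u) (at u)"
      if "u \<in> {a<..<a + 1}" for u
    proof -
      have p: "((\<lambda>u. (u - a) * (a + 1 - u) / 2) has_real_derivative (a + 1 / 2 - u)) (at u)"
        by (auto intro!: derivative_eq_intros simp: field_simps)
      have q: "((\<lambda>u. a + 1 / 2 - u) has_real_derivative - 1) (at u)"
        by (auto intro!: derivative_eq_intros)
      have "(F has_vector_derivative
          (((u - a) * (a + 1 - u) / 2) *\<^sub>R g'' u + (a + 1 / 2 - u) *\<^sub>R g' u)
          - ((a + 1 / 2 - u) *\<^sub>R g' u + (- 1) *\<^sub>R g u) - g u) (at u)"
        unfolding F_def
        by (intro has_vector_derivative_diff has_vector_derivative_scaleR p q g g' G that)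
      then show ?thesis by simp
    qed
  qed simp
  also have "F (a + 1) - F a = (1 / 2) *\<^sub>R (g a + g (a + 1)) - (G (a + 1) - G a)"
    using scaleR_half_double[of "g (a + 1)"] by (simp add: F_def algebra_simps flip: scaleR_add_left)
  finally show ?thesis .
qed

text \<open>The factor \<open>s - 1\<close> clears the denominator of the Euler--Maclaurin remainder, so that the term is entire.\<close>

definition em_term :: "nat \<Rightarrow> complex \<Rightarrow> complex" where
  "em_term n s = (s - 1) * (of_nat (Suc n) powr - s + of_nat (Suc (Suc n)) powr - s) / 2
     + (of_nat (Suc (Suc n)) powr (1 - s) - of_nat (Suc n) powr (1 - s))"

lemma holomorphic_em_term: "em_term n holomorphic_on A"
  unfolding em_term_def by (intro holomorphic_intros) auto

lemma has_vector_derivative_of_real_powr: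
  assumes "u > 0"
  shows "((\<lambda>u. complex_of_real u powr z) has_vector_derivative z * of_real u powr (z - 1)) (at u)"
proof -
  have "((\<lambda>x. x powr z) has_field_derivative z * of_real u powr (z - 1)) (at (of_real u))"
    using assms by (intro has_field_derivative_powr) auto
  from field_vector_diff_chain_at[OF has_vector_derivative_of_real[OF DERIV_ident] this]
  show ?thesis by (simp add: o_def)
qed

text \<open>The trapezoidal error for \<open>u powr - s\<close> on one unit interval, with the
  second derivative \<open>s * (s + 1) * u powr (- s - 2)\<close> inside the integral. This form
  exhibits a decay two powers better than that of \<open>u powr - s\<close>.\<close>

lemma em_term_has_integral:
  assumes "s \<noteq> 1"
  shows "((\<lambda>u. ((u - real (Suc n)) * (real (Suc n) + 1 - u) / 2) *\<^sub>R
      (s * (s + 1) * of_real u powr (- s - 2))) has_integral em_term n s / (s - 1))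
      {real (Suc n)..real (Suc n) + 1}"
proof -
  let ?a = "real (Suc n)"
  have cont: "continuous_on {?a..?a + 1} (\<lambda>u. complex_of_real u powr z)" for z
    by (intro continuous_at_imp_continuous_on ballI
          has_vector_derivative_continuous[OF has_vector_derivative_of_real_powr]) auto
  have "((\<lambda>u. ((u - ?a) * (?a + 1 - u) / 2) *\<^sub>R (s * (s + 1) * of_real u powr (- s - 2))) has_integral
      (1 / 2) *\<^sub>R (of_real ?a powr - s + of_real (?a + 1) powr - s)
      - (of_real (?a + 1) powr (1 - s) / (1 - s) - of_real ?a powr (1 - s) / (1 - s))) {?a..?a + 1}"
  proof (rule integral_parabola_second_deriv[where g' = "\<lambda>u. - s * of_real u powr (- s - 1)"])
    show "continuous_on {?a..?a + 1} (\<lambda>u. ((u - ?a) * (?a + 1 - u) / 2) *\<^sub>R (- s * of_real u powr (- s - 1)))"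
      "continuous_on {?a..?a + 1} (\<lambda>u. complex_of_real u powr - s)"
      "continuous_on {?a..?a + 1} (\<lambda>u. complex_of_real u powr (1 - s) / (1 - s))"
      using assms by (auto intro!: continuous_intros cont)
    fix u assume u: "u \<in> {?a<..<?a + 1}"
    then have u0: "u > 0" by (simp add: less_trans[of 0 ?a])
    show "((\<lambda>u. complex_of_real u powr - s) has_vector_derivative - s * of_real u powr (- s - 1)) (at u)"
      using has_vector_derivative_of_real_powr[OF u0, of "- s"] by simp
    show "((\<lambda>u. - s * complex_of_real u powr (- s - 1)) has_vector_derivative
        s * (s + 1) * of_real u powr (- s - 2)) (at u)"
      using has_vector_derivative_mult_right[OF has_vector_derivative_of_real_powr[OF u0, of "- s - 1"], of "- s"]
      by (simp add: algebra_simps)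
    show "((\<lambda>u. complex_of_real u powr (1 - s) / (1 - s)) has_vector_derivative of_real u powr - s) (at u)"
      using has_vector_derivative_divide[OF has_vector_derivative_of_real_powr[OF u0, of "1 - s"], of "1 - s"] assms
      by simp
  qed
  moreover have "(1 / 2) *\<^sub>R (of_real ?a powr - s + of_real (?a + 1) powr - s)
      - (of_real (?a + 1) powr (1 - s) / (1 - s) - of_real ?a powr (1 - s) / (1 - s)) = em_term n s / (s - 1)"
  proof -
    have eq: "complex_of_real (?a + 1) = of_nat (Suc (Suc n))" "complex_of_real ?a = of_nat (Suc n)"
      by simp_all
    have "(1 / 2) *\<^sub>R (x + y) - (p / (1 - s) - q / (1 - s)) = ((s - 1) * (x + y) / 2 + (p - q)) / (s - 1)"
      for x y p q :: complex
    proof -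
      have "p / (1 - s) - q / (1 - s) = - ((p - q) / (s - 1))"
        using minus_divide_right[of "p - q" "s - 1"] by (simp add: diff_divide_distrib)
      moreover have "(s - 1) * (x + y) / 2 / (s - 1) = (1 / 2) *\<^sub>R (x + y)"
        using assms nonzero_mult_div_cancel_left[of "s - 1" "(x + y) / 2"] by (simp add: scaleR_conv_of_real)
      ultimately show ?thesis by (simp only: add_divide_distrib) simp
    qed
    then show ?thesis unfolding em_term_def eq .
  qed
  ultimately show ?thesis by simp
qed

lemma norm_em_term_le:
  assumes "Re s > - 2"
  shows "norm (em_term n s) \<le> norm (s - 1) * norm s * norm (s + 1) / 2 * real (Suc n) powr (- Re s - 2)"
proof (cases "s = 1")
  case False
  let ?a = "real (Suc n)"
  have "norm (em_term n s / (s - 1)) \<le>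
      (norm s * norm (s + 1) * ?a powr (- Re s - 2) / 2) * measure lborel (cbox ?a (?a + 1))"
  proof (rule has_integral_bound)
    show "((\<lambda>u. ((u - ?a) * (?a + 1 - u) / 2) *\<^sub>R (s * (s + 1) * of_real u powr (- s - 2)))
      has_integral em_term n s / (s - 1)) (cbox ?a (?a + 1))"
      using em_term_has_integral[OF False, of n] by simp
    fix u assume u: "u \<in> cbox ?a (?a + 1)"
    have "norm (complex_of_real u powr (- s - 2)) = u powr (- Re s - 2)"
      using u by (subst norm_powr_real_powr) auto
    also have "\<dots> \<le> ?a powr (- Re s - 2)"
      using u assms by (intro powr_mono2') auto
    finally have 1: "norm (complex_of_real u powr (- s - 2)) \<le> ?a powr (- Re s - 2)" .
    have "(u - ?a) * (?a + 1 - u) \<le> 1 * 1"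
      using u by (intro mult_mono) auto
    moreover have "0 \<le> (u - ?a) * (?a + 1 - u)"
      using u by (intro mult_nonneg_nonneg) auto
    ultimately have "\<bar>(u - ?a) * (?a + 1 - u) / 2\<bar> \<le> 1 / 2" by simp
    then have "\<bar>(u - ?a) * (?a + 1 - u) / 2\<bar> * (norm s * norm (s + 1) * norm (complex_of_real u powr (- s - 2)))
        \<le> 1 / 2 * (norm s * norm (s + 1) * ?a powr (- Re s - 2))"
      using 1 by (intro mult_mono) auto
    then show "norm (((u - ?a) * (?a + 1 - u) / 2) *\<^sub>R (s * (s + 1) * of_real u powr (- s - 2)))
        \<le> norm s * norm (s + 1) * ?a powr (- Re s - 2) / 2"
      by (simp add: norm_mult)
  qed simp
  then have "norm (em_term n s) / norm (s - 1) \<le> norm s * norm (s + 1) * ?a powr (- Re s - 2) / 2"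
    by (simp add: norm_divide)
  then show ?thesis using False by (simp add: field_simps)
next
  \<comment> \<open>The integral formula divides by \<open>s - 1\<close>. At \<open>s = 1\<close>
    both sides vanish: one summand of \<open>em_term\<close> carries the factor
    \<open>s - 1\<close>, and in the other both powers have exponent 0.\<close>
  case True
  have "complex_of_nat (Suc k) powr 0 = 1" for k by (simp del: of_nat_Suc)
  with True show ?thesis by (simp add: em_term_def del: of_nat_Suc)
qed

text \<open>The exponent \<open>- Re s - 2\<close> is below -1 exactly for Re s > -1, and the
  polynomial factor is bounded on small closed balls, so the series converges locally
  uniformly.\<close>

lemma em_series:
  shows holomorphic_em_series: "(\<lambda>s. \<Sum>n. em_term n s) holomorphic_on {s. Re s > - 1}"
    and summable_em_term: "Re s > - 1 \<Longrightarrow> summable (\<lambda>n. em_term n s)"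
proof -
  let ?S = "{s. Re s > - 1}"
  have opn: "open ?S" by (rule open_halfspace_Re_gt)
  have bnd: "\<exists>d h. 0 < d \<and> summable h \<and> (\<forall>n. \<forall>y\<in>ball x d \<inter> ?S. norm (em_term n y) \<le> h n)"
    if "x \<in> ?S" for x
  proof -
    define d where "d = (Re x + 1) / 2"
    have d: "d > 0" using that unfolding d_def by simp
    define q where "q = (\<lambda>y::complex. (y - 1) * y * (y + 1) / 2)"
    have "compact (q ` cball x d)"
      unfolding q_def by (intro compact_continuous_image continuous_intros) auto
    then have "bounded (q ` cball x d)" by (rule compact_imp_bounded)
    then obtain M where M: "\<And>y. y \<in> cball x d \<Longrightarrow> norm (q y) \<le> M"
      unfolding bounded_iff by blast
    have M0: "M \<ge> 0" using M[of x] d norm_ge_zero[of "q x"] by (simp del: norm_ge_zero)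
    have "norm (em_term n y) \<le> M * real (Suc n) powr (-1 - d)" if y: "y \<in> ball x d \<inter> ?S" for n y
    proof -
      have "\<bar>Re (x - y)\<bar> \<le> norm (x - y)" by (rule abs_Re_le_cmod)
      also have "\<dots> < d" using y by (simp add: dist_norm)
      finally have "Re x - Re y < d" by simp
      then have "Re y + 1 \<ge> d" unfolding d_def by (simp add: field_simps)
      then have "real (Suc n) powr (- Re y - 2) \<le> real (Suc n) powr (-1 - d)"
        by (intro powr_mono) auto
      moreover have "norm (y - 1) * norm y * norm (y + 1) / 2 \<le> M"
        using y M[of y] by (simp add: q_def norm_mult norm_divide)
      ultimately have "norm (y - 1) * norm y * norm (y + 1) / 2 * real (Suc n) powr (- Re y - 2)
          \<le> M * real (Suc n) powr (-1 - d)"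
        by (intro mult_mono) (auto simp: M0)
      with norm_em_term_le[of y n] y show ?thesis by auto
    qed
    moreover have "summable (\<lambda>n. M * real (Suc n) powr (-1 - d))"
      using d by (intro summable_mult summable_Suc_powr) auto
    ultimately show ?thesis using d by blast
  qed
  show "(\<lambda>s. \<Sum>n. em_term n s) holomorphic_on ?S"
    by (rule holomorphic_series(1)[OF opn holomorphic_em_term bnd])
  show "Re s > - 1 \<Longrightarrow> summable (\<lambda>n. em_term n s)"
    using holomorphic_series(2)[OF opn holomorphic_em_term bnd, of s] by simp
qed

text \<open>In the sum of the trapezoidal errors the half sums produce zeta twice, less the first
  term 1, and the powers with exponent 1 - s telescope to -1.\<close>

lemma zeta_euler_maclaurin_aux:
  assumes s: "Re s > 1"
  shows "(s - 1) * zeta s = 1 + (s - 1) / 2 + (\<Sum>n. em_term n s)"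
proof -
  define a where "a = (\<lambda>n. of_nat (Suc n) powr - s :: complex)"
  define b where "b = (\<lambda>n. of_nat (Suc n) powr (1 - s) :: complex)"
  have z: "a sums zeta s" unfolding a_def by (rule zeta_sums[OF s])
  then have z': "(\<lambda>n. a (Suc n)) sums (zeta s - 1)"
    by (subst sums_Suc_iff) (simp add: a_def)
  have "(\<lambda>n. norm (b n)) \<longlonglongrightarrow> 0"
  proof -
    have "(\<lambda>n. real n powr (1 - Re s)) \<longlonglongrightarrow> 0"
      using s by (intro tendsto_neg_powr filterlim_real_sequentially) auto
    from LIMSEQ_Suc[OF this] show ?thesis unfolding b_def norm_Suc_powr by simp
  qed
  then have "b \<longlonglongrightarrow> 0" by (rule tendsto_norm_zero_cancel)
  from telescope_sums[OF this] have tel: "(\<lambda>n. b (Suc n) - b n) sums (- 1)"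
    unfolding b_def by simp
  have "(\<lambda>n. (s - 1) / 2 * (a n + a (Suc n)) + (b (Suc n) - b n)) sums
      ((s - 1) / 2 * (zeta s + (zeta s - 1)) + - 1)"
    by (intro sums_add sums_mult z z' tel)
  moreover have "(\<lambda>n. (s - 1) / 2 * (a n + a (Suc n)) + (b (Suc n) - b n)) = (\<lambda>n. em_term n s)"
    unfolding a_def b_def em_term_def by (auto simp: fun_eq_iff)
  ultimately have "(\<Sum>n. em_term n s) = (s - 1) / 2 * (zeta s + (zeta s - 1)) + - 1"
    by (simp add: sums_iff)
  then show ?thesis by (simp add: field_simps)
qed

text \<open>Identity theorem on a punctured half-plane. The point 1 has to go: \<open>zeta 1\<close>
  is the default value 0, so the left side is 0 there, while the right side is 1.\<close>

lemma zeta_euler_maclaurin: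
  assumes "Re s > - 1" "s \<noteq> 1"
  shows "(s - 1) * zeta s = 1 + (s - 1) / 2 + (\<Sum>n. em_term n s)"
proof (rule analytic_continuation_open[of "{s. Re s > 1}" "{s. Re s > - 1} - {1}" _ _ s])
  have "Re 2 > 1" by simp
  then show "{s. Re s > 1} \<noteq> {}" by blast
  show "open ({s. Re s > - 1} - {1})" by (intro open_Diff open_halfspace_Re_gt) auto
  show "connected ({s. Re s > - 1} - {1})"
    by (intro connected_open_delete open_halfspace_Re_gt convex_connected convex_halfspace_Re_gt) auto
  show "(\<lambda>s. (s - 1) * zeta s) holomorphic_on {s. Re s > - 1} - {1}"
    by (intro holomorphic_intros holomorphic_on_subset[OF zeta_holomorphic]) auto
  show "(\<lambda>s. 1 + (s - 1) / 2 + (\<Sum>n. em_term n s)) holomorphic_on {s. Re s > - 1} - {1}"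
    by (intro holomorphic_intros holomorphic_on_subset[OF holomorphic_em_series]) auto
qed (use assms in \<open>auto simp: open_halfspace_Re_gt intro!: zeta_euler_maclaurin_aux\<close>)

text \<open>The factor \<open>norm (s - 1)\<close> is taken out of every term of the
  Euler--Maclaurin formula and cancelled; its being at least 1 pays for the boundary term 1. As
  \<open>a > - 1\<close>, one convergent series \<open>h\<close> controls the remainders for all Re
  s \<ge> a.\<close>

lemma zeta_polynomial_bound:
  assumes "a > - 1"
  obtains C where "C > 0" "\<And>s. Re s \<ge> a \<Longrightarrow> norm (s - 1) \<ge> 1 \<Longrightarrow> norm (zeta s) \<le> C * (1 + norm s) ^ 2"
proof -
  define h where "h = (\<lambda>n. real (Suc n) powr (- a - 2))"
  define S where "S = suminf h"
  have h: "summable h" unfolding h_def using assms by (intro summable_Suc_powr) auto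
  have S0: "S \<ge> 0" unfolding S_def using h by (intro suminf_nonneg) (auto simp: h_def)
  have "norm (zeta s) \<le> (2 + S) * (1 + norm s) ^ 2" if s: "Re s \<ge> a" "norm (s - 1) \<ge> 1" for s
  proof -
    have s1: "s \<noteq> 1" using s(2) by auto
    have "norm (em_term n s) \<le> norm (s - 1) * (norm s * norm (s + 1)) / 2 * h n" for n
    proof -
      have "norm (em_term n s) \<le> norm (s - 1) * norm s * norm (s + 1) / 2 * real (Suc n) powr (- Re s - 2)"
        using s assms by (intro norm_em_term_le) auto
      also have "\<dots> \<le> norm (s - 1) * norm s * norm (s + 1) / 2 * h n"
        unfolding h_def using s by (intro mult_left_mono powr_mono) auto
      finally show ?thesis by (simp add: mult_ac)
    qed
    then have "norm (\<Sum>n. em_term n s) \<le> (\<Sum>n. norm (s - 1) * (norm s * norm (s + 1)) / 2 * h n)"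
      by (intro norm_suminf_le summable_mult h)
    also have "\<dots> = norm (s - 1) * (norm s * norm (s + 1) / 2 * S)"
      by (subst suminf_mult[OF h]) (simp add: S_def)
    finally have 1: "norm (\<Sum>n. em_term n s) \<le> norm (s - 1) * (norm s * norm (s + 1) / 2 * S)" .
    have "norm (s - 1) * norm (zeta s) = norm (1 + (s - 1) / 2 + (\<Sum>n. em_term n s))"
      using zeta_euler_maclaurin[of s] s assms s1 by (simp flip: norm_mult)
    also have "\<dots> \<le> norm (1::complex) + norm ((s - 1) / 2) + norm (\<Sum>n. em_term n s)"
      by (intro norm_triangle_le add_mono order_refl)
    also have "\<dots> \<le> norm (s - 1) * 1 + norm (s - 1) * (1 / 2) + norm (s - 1) * (norm s * norm (s + 1) / 2 * S)"
      using 1 s(2) by (intro add_mono) (auto simp: norm_divide)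
    also have "\<dots> = norm (s - 1) * (3 / 2 + norm s * norm (s + 1) / 2 * S)"
      by (simp add: algebra_simps)
    finally have "norm (zeta s) \<le> 3 / 2 + norm s * norm (s + 1) / 2 * S"
      using s1 by (subst (asm) mult_le_cancel_left_pos) auto
    also have "\<dots> \<le> 2 * (1 + norm s) ^ 2 + (1 + norm s) ^ 2 * S"
    proof (intro add_mono mult_right_mono S0)
      have "1 \<le> (1 + norm s) ^ 2" by simp
      then show "3 / 2 \<le> 2 * (1 + norm s) ^ 2" by linarith
      have "norm s * norm (s + 1) \<le> (1 + norm s) * (1 + norm s)"
        using norm_triangle_ineq[of s 1] by (intro mult_mono) auto
      then show "norm s * norm (s + 1) / 2 \<le> (1 + norm s) ^ 2"
        using mult_nonneg_nonneg[OF norm_ge_zero norm_ge_zero, of s "s + 1"]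
        unfolding power2_eq_square by linarith
    qed
    finally show ?thesis by (simp add: algebra_simps)
  qed
  then show ?thesis using S0 by (intro that[of "2 + S"]) auto
qed

section \<open>The functional equation\<close>

text \<open>Logarithmic derivative of the reflection formula for Gamma.\<close>

lemma Digamma_reflection:
  fixes z :: complex
  assumes "z \<notin> \<int>"
  shows "Digamma z - Digamma (1 - z) = - of_real pi * cos (of_real pi * z) / sin (of_real pi * z)"
proof -
  have s0: "sin (of_real pi * z) \<noteq> 0"
    using assms by (subst mult.commute) (auto simp: sin_eq_0 mult.commute)
  have z1: "z \<notin> \<int>\<^sub>\<le>\<^sub>0" using assms nonpos_Ints_Int by blast
  have z2: "1 - z \<notin> \<int>\<^sub>\<le>\<^sub>0"
    using assms nonpos_Ints_Int[of "1 - z"] Ints_diff[of 1 "1 - z"] by auto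
  have "((\<lambda>z. Gamma z * Gamma (1 - z)) has_field_derivative
      Gamma z * Gamma (1 - z) * (Digamma z - Digamma (1 - z))) (at z)"
    using z1 z2 by (auto intro!: derivative_eq_intros simp: algebra_simps)
  moreover have "((\<lambda>z. of_real pi / sin (of_real pi * z)) has_field_derivative
      - (of_real pi * (cos (of_real pi * z) * of_real pi)) / (sin (of_real pi * z))\<^sup>2) (at z)"
    using s0 by (auto intro!: derivative_eq_intros simp: power2_eq_square)
  ultimately have "Gamma z * Gamma (1 - z) * (Digamma z - Digamma (1 - z)) =
      - (of_real pi * (cos (of_real pi * z) * of_real pi)) / (sin (of_real pi * z))\<^sup>2"
    unfolding Gamma_reflection_complex by (rule DERIV_unique)
  then have "of_real pi / sin (of_real pi * z) * (Digamma z - Digamma (1 - z)) =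
      of_real pi / sin (of_real pi * z) * (- of_real pi * cos (of_real pi * z) / sin (of_real pi * z))"
    unfolding Gamma_reflection_complex by (simp add: power2_eq_square)
  then show ?thesis using s0 by (subst (asm) mult_cancel_left) auto
qed

text \<open>Subtracting the Digamma series at 1 + z and 1 - z, with z = \<i> y, pairs the poles into
  the terms of the sum. The reflection formula evaluates the difference; on the imaginary axis its
  cotangent becomes hyperbolic.\<close>

lemma coth_partial_fractions:
  fixes y :: real
  assumes "y > 0"
  shows "(\<lambda>k. 2 * y / ((real k + 1)\<^sup>2 + y\<^sup>2)) sums (pi * cosh (pi * y) / sinh (pi * y) - 1 / y)"
proof -
  define z where "z = \<i> * of_real y"
  have zI: "z \<notin> \<int>"
  proof
    assume "z \<in> \<int>"
    then obtain m where "z = of_int m" by (auto elim: Ints_cases)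
    then have "Im z = 0" by simp
    then show False using assms by (simp add: z_def)
  qed
  have z0: "z \<noteq> 0" "1 + z \<noteq> 0" "1 - z \<noteq> 0"
    using assms by (auto simp: z_def complex_eq_iff)
  have "(\<lambda>k. (inverse (of_nat (Suc k)) - inverse (1 + z + of_nat k))
       - (inverse (of_nat (Suc k)) - inverse (1 - z + of_nat k))) sums
       ((Digamma (1 + z) + euler_mascheroni) - (Digamma (1 - z) + euler_mascheroni))"
    unfolding Digamma_def diff_add_cancel
    by (intro sums_diff summable_sums summable_Digamma z0)
  moreover have "(inverse (of_nat (Suc k)) - inverse (1 + z + of_nat k))
       - (inverse (of_nat (Suc k)) - inverse (1 - z + of_nat k)) =
       \<i> * of_real (2 * y / ((real k + 1)\<^sup>2 + y\<^sup>2))" for k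
  proof -
    have nz: "1 + z + of_nat k \<noteq> 0" "1 - z + of_nat k \<noteq> 0"
      using assms by (auto simp: z_def complex_eq_iff)
    have "(1 + z + of_nat k) * (1 - z + of_nat k) = (of_nat k + 1)\<^sup>2 - z\<^sup>2"
      by (simp add: algebra_simps power2_eq_square)
    also have "z\<^sup>2 = - of_real (y\<^sup>2)"
      by (simp add: z_def power_mult_distrib)
    finally have e: "(1 + z + of_nat k) * (1 - z + of_nat k) = of_real ((real k + 1)\<^sup>2 + y\<^sup>2)"
      by simp
    have "(inverse (of_nat (Suc k)) - inverse (1 + z + of_nat k))
       - (inverse (of_nat (Suc k)) - inverse (1 - z + of_nat k)) =
       2 * z / ((1 + z + of_nat k) * (1 - z + of_nat k))"
      using nz by (simp add: divide_simps) (simp add: algebra_simps)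
    then show ?thesis unfolding e by (simp add: z_def)
  qed
  moreover have "(Digamma (1 + z) + euler_mascheroni) - (Digamma (1 - z) + euler_mascheroni) =
      \<i> * of_real (pi * cosh (pi * y) / sinh (pi * y) - 1 / y)"
  proof -
    have "Digamma (1 + z) = Digamma z + 1 / z"
      using Digamma_plus1[OF z0(1)] by (simp add: add.commute)
    then have "(Digamma (1 + z) + euler_mascheroni) - (Digamma (1 - z) + euler_mascheroni) =
        1 / z - of_real pi * cos (of_real pi * z) / sin (of_real pi * z)"
      using Digamma_reflection[OF zI] by (simp add: algebra_simps)
    also have "of_real pi * z = \<i> * of_real (pi * y)" by (simp add: z_def)
    also have "cos (\<i> * of_real (pi * y)) = of_real (cosh (pi * y))"
      by (simp add: cos_i_times cosh_field_def exp_minus flip: exp_of_real)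
    also have "sin (\<i> * of_real (pi * y)) = \<i> * of_real (sinh (pi * y))"
      by (simp add: sin_i_times sinh_field_def exp_minus flip: exp_of_real)
    also have "1 / z - of_real pi * of_real (cosh (pi * y)) / (\<i> * of_real (sinh (pi * y))) =
        \<i> * of_real (pi * cosh (pi * y) / sinh (pi * y) - 1 / y)"
    proof -
      have "a / (\<i> * b) = - \<i> * (a / b)" for a b :: complex
        by (cases "b = 0") (simp_all add: field_simps)
      then show ?thesis unfolding z_def by (simp only:) (simp add: algebra_simps)
    qed
    finally show ?thesis .
  qed
  ultimately have "(\<lambda>k. \<i> * of_real (2 * y / ((real k + 1)\<^sup>2 + y\<^sup>2))) sums
      (\<i> * of_real (pi * cosh (pi * y) / sinh (pi * y) - 1 / y))"
    by simp
  from sums_Im[OF this] show ?thesis by simp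
qed

text \<open>With \<open>x = 2 * pi * y\<close>, half of the hyperbolic cotangent of
  \<open>pi * y\<close> is \<open>1 / (exp x - 1) + 1 / 2\<close>, and \<open>- 1 / x\<close>
  removes its pole at 0.\<close>

lemma planck_kernel_partial_fractions:
  fixes x :: real
  assumes "x > 0"
  shows "(\<lambda>k. 2 * x / (x\<^sup>2 + (2 * pi * (real k + 1))\<^sup>2)) sums (1 / (exp x - 1) - 1 / x + 1 / 2)"
proof -
  define y where "y = x / (2 * pi)"
  have y: "y > 0" using assms by (simp add: y_def)
  have x: "x = 2 * pi * y" by (simp add: y_def)
  have "1 / (2 * pi) * (2 * y / ((real k + 1)\<^sup>2 + y\<^sup>2)) = 2 * x / (x\<^sup>2 + (2 * pi * (real k + 1))\<^sup>2)" for k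
  proof -
    have "x\<^sup>2 + (2 * pi * (real k + 1))\<^sup>2 = (2 * pi)\<^sup>2 * ((real k + 1)\<^sup>2 + y\<^sup>2)"
      proof -
      have "(2 * pi * y)\<^sup>2 + (2 * pi * m)\<^sup>2 = (2 * pi)\<^sup>2 * (m\<^sup>2 + y\<^sup>2)" for m
        by (simp add: power_mult_distrib algebra_simps)
      then show ?thesis unfolding x .
    qed
    moreover have "(real k + 1)\<^sup>2 + y\<^sup>2 \<noteq> 0"
      using y by (simp add: add_nonneg_eq_0_iff)
    moreover have "1 / p * (2 * y / d) = 2 * (p * y) / (p\<^sup>2 * d)" if "p > 0" "d \<noteq> 0" for p d :: real
      using that by (simp add: power2_eq_square)
    ultimately show ?thesis by (simp add: x power2_eq_square)
  qed
  with sums_mult[OF coth_partial_fractions[OF y], of "1 / (2 * pi)"]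
  have "(\<lambda>k. 2 * x / (x\<^sup>2 + (2 * pi * (real k + 1))\<^sup>2)) sums
      (1 / (2 * pi) * (pi * cosh (pi * y) / sinh (pi * y) - 1 / y))"
    by simp
  also have "1 / (2 * pi) * (pi * cosh (pi * y) / sinh (pi * y) - 1 / y) = 1 / (exp x - 1) - 1 / x + 1 / 2"
  proof -
    define e where "e = exp (pi * y)"
    have e: "e > 1" using y by (simp add: e_def)
    have ex: "exp x = e * e" by (simp add: e_def x flip: exp_add)
    have ee: "e * e > 1" using e by (simp add: less_1_mult)
    have "cosh (pi * y) / sinh (pi * y) = (e * e + 1) / (e * e - 1)"
    proof -
      have "cosh (pi * y) = (e * e + 1) / (2 * e)" "sinh (pi * y) = (e * e - 1) / (2 * e)"
        using e by (simp_all add: cosh_def sinh_def e_def exp_minus field_simps)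
      then show ?thesis using e ee by simp
    qed
    also have "\<dots> = 1 + 2 / (e * e - 1)" using ee by (simp add: field_simps)
    finally have c: "cosh (pi * y) / sinh (pi * y) = 1 + 2 / (e * e - 1)" .
    have "1 / (2 * pi) * (pi * cosh (pi * y) / sinh (pi * y) - 1 / y) =
        1 / 2 * (cosh (pi * y) / sinh (pi * y)) - 1 / x"
      using y by (simp add: x right_diff_distrib)
    also have "\<dots> = 1 / (exp x - 1) - 1 / x + 1 / 2" unfolding c ex by (simp add: field_simps)
    finally show ?thesis .
  qed
  finally show ?thesis .
qed

section \<open>Mellin transform of one partial fraction\<close>

lemma nn_integral_Gamma_scaled:
  fixes a u :: real
  assumes "a > 0" "u > 0"
  shows "(\<integral>\<^sup>+x\<in>{0<..}. ennreal (x powr (a - 1) * exp (- u * x)) \<partial>lborel) = ennreal (Gamma a * u powr - a)"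
proof -
  have "(\<integral>\<^sup>+x\<in>{0<..}. ennreal (x powr (a - 1) * exp (- x)) \<partial>lborel) =
      (\<integral>\<^sup>+t. ennreal (indicator {0..} t * t powr (a - 1) / exp t) \<partial>lborel)"
    by (intro nn_integral_cong) (auto simp: indicator_def exp_minus field_simps)
  also have "\<dots> = ennreal (Gamma a)" using Gamma_conv_nn_integral_real[OF assms(1)] by simp
  finally have "ennreal (Gamma a) = (\<integral>\<^sup>+x. ennreal (x powr (a - 1) * exp (- x)) * indicator {0<..} x \<partial>lborel)" ..
  also have "\<dots> = ennreal u * (\<integral>\<^sup>+x. ennreal ((0 + u * x) powr (a - 1) * exp (- (0 + u * x))) *
      indicator {0<..} (0 + u * x) \<partial>lborel)"
    using assms(2) nn_integral_real_affine[of "\<lambda>x. ennreal (x powr (a - 1) * exp (- x)) * indicator {0<..} x" u 0]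
    by simp
  also have "(\<integral>\<^sup>+x. ennreal ((0 + u * x) powr (a - 1) * exp (- (0 + u * x))) *
      indicator {0<..} (0 + u * x) \<partial>lborel) =
      (\<integral>\<^sup>+x. ennreal (u powr (a - 1)) * (ennreal (x powr (a - 1) * exp (- u * x)) * indicator {0<..} x) \<partial>lborel)"
    using assms(2)
    by (intro nn_integral_cong)
       (auto simp: indicator_def powr_mult zero_less_mult_iff mult.assoc simp flip: ennreal_mult')
  also have "\<dots> = ennreal (u powr (a - 1)) * (\<integral>\<^sup>+x\<in>{0<..}. ennreal (x powr (a - 1) * exp (- u * x)) \<partial>lborel)"
    by (rule nn_integral_cmult) measurable
  finally have *: "ennreal (Gamma a) = ennreal (u powr a) *
      (\<integral>\<^sup>+x\<in>{0<..}. ennreal (x powr (a - 1) * exp (- u * x)) \<partial>lborel)"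
    using assms(2) by (simp add: mult.assoc[symmetric] powr_diff flip: ennreal_mult')
  have "ennreal (Gamma a * u powr - a) = ennreal (u powr - a) * ennreal (Gamma a)"
    using assms by (simp add: mult.commute flip: ennreal_mult')
  also have "\<dots> = (\<integral>\<^sup>+x\<in>{0<..}. ennreal (x powr (a - 1) * exp (- u * x)) \<partial>lborel)"
    unfolding * using assms(2)
    by (simp add: mult.assoc[symmetric] powr_minus flip: ennreal_mult')
  finally show ?thesis ..
qed

text \<open>Gamma integral under the substitution \<open>u * x\<^sup>2\<close>. The endpoint 0 is
  discarded first, which makes the substitution a bijection of the open half-line.\<close>

lemma nn_integral_Gamma_square:
  fixes a u :: real
  assumes "a > 0" "u > 0"
  shows "(\<integral>\<^sup>+x\<in>{0<..}. ennreal (2 * x powr (2 * a - 1) * exp (- u * x\<^sup>2)) \<partial>lborel) = ennreal (Gamma a * u powr - a)"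
proof -
  define f :: "real \<Rightarrow> real" where "f = (\<lambda>x. x powr (a - 1) / exp x)"
  define h where "h = (\<lambda>x. 2 * x powr (2 * a - 1) * exp (- u * x\<^sup>2))"
  have img: "(\<lambda>x. u * x\<^sup>2) ` {0<..} = {0<..}"
  proof safe
    fix x :: real assume "x > 0"
    then show "x \<in> (\<lambda>x. u * x\<^sup>2) ` {0<..}"
      using assms by (intro image_eqI[of _ _ "sqrt (x / u)"]) auto
  qed (use assms in auto)
  have "(f has_integral Gamma a) {0..}"
    unfolding f_def by (rule Gamma_integral_real[OF assms(1)])
  also have "?this \<longleftrightarrow> (f has_integral Gamma a) {0<..}"
  proof (rule has_integral_spike_set_eq)
    show "negligible {x \<in> {0..} - {0<..}. f x \<noteq> 0}"
      by (rule negligible_subset[of "{0}"]) auto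
    show "negligible {x \<in> {0<..} - {0..}. f x \<noteq> 0}"
      by (rule negligible_subset[of "{}"]) auto
  qed
  finally have f: "(f has_integral Gamma a) {0<..}" .
  then have "f absolutely_integrable_on {0<..}"
    by (intro nonnegative_absolutely_integrable_1) (auto simp: f_def)
  with f have "f absolutely_integrable_on (\<lambda>x. u * x\<^sup>2) ` {0<..} \<and> integral ((\<lambda>x. u * x\<^sup>2) ` {0<..}) f = Gamma a"
    unfolding img by auto
  then have "(\<lambda>x. \<bar>2 * u * x\<bar> * f (u * x\<^sup>2)) absolutely_integrable_on {0<..} \<and>
      integral {0<..} (\<lambda>x. \<bar>2 * u * x\<bar> * f (u * x\<^sup>2)) = Gamma a"
    using assms(2)
    by (subst has_absolute_integral_change_of_variables_1')
       (auto intro!: derivative_eq_intros inj_onI simp: power2_eq_iff_nonneg)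
  then have "((\<lambda>x. \<bar>2 * u * x\<bar> * f (u * x\<^sup>2)) has_integral Gamma a) {0<..}"
    by (auto simp: has_integral_iff set_lebesgue_integral_eq_integral(1))
  from has_integral_mult_right[OF this, of "u powr - a"]
  have "((\<lambda>x. u powr - a * (\<bar>2 * u * x\<bar> * f (u * x\<^sup>2))) has_integral u powr - a * Gamma a) {0<..}" .
  also have "?this \<longleftrightarrow> (h has_integral Gamma a * u powr - a) {0<..}"
  proof (rule has_integral_cong[THEN trans])
    fix x :: real assume "x \<in> {0<..}"
    then have x: "x > 0" by simp
    have "(x\<^sup>2) powr (a - 1) = x powr (2 * (a - 1))"
      using x by (simp add: powr_powr flip: powr_numeral)
    then have "x * (x\<^sup>2) powr (a - 1) = x powr (2 * a - 1)"
      using x powr_add[of x 1 "2 * (a - 1)"] by (simp add: algebra_simps)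
    moreover have "u powr - a * (u * u powr (a - 1)) = 1"
    proof -
      have "u * u powr (a - 1) = u powr a" using assms(2) powr_add[of u 1 "a - 1"] by simp
      then show ?thesis using assms(2) by (simp flip: powr_add)
    qed
    moreover have "u powr - a * (\<bar>2 * u * x\<bar> * f (u * x\<^sup>2)) =
        (u powr - a * (u * u powr (a - 1))) * (2 * (x * (x\<^sup>2) powr (a - 1)) * exp (- u * x\<^sup>2))"
      using x assms(2) by (simp add: f_def powr_mult exp_minus divide_inverse mult_ac)
    ultimately show "u powr - a * (\<bar>2 * u * x\<bar> * f (u * x\<^sup>2)) = h x"
      by (simp add: h_def)
  qed (simp add: mult.commute)
  finally show ?thesis
    using nn_integral_has_integral_lebesgue'[of "{0<..}" h] by (simp add: h_def)
qed

text \<open>Write \<open>1 / (x\<^sup>2 + c\<^sup>2)\<close> as the integral of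
  \<open>exp (- v * (x\<^sup>2 + c\<^sup>2))\<close> over v > 0 and exchange the integrals: each
  variable contributes one Gamma integral. The range of \<open>s\<close> is what makes both Gamma
  arguments positive.\<close>

lemma nn_integral_mellin_kernel:
  fixes s c :: real
  assumes "-1 < s" "s < 1" "c > 0"
  shows "(\<integral>\<^sup>+x\<in>{0<..}. ennreal (2 * x powr s / (x\<^sup>2 + c\<^sup>2)) \<partial>lborel) =
      ennreal (Gamma ((1 + s) / 2) * Gamma ((1 - s) / 2) * c powr (s - 1))"
proof -
  define F where "F = (\<lambda>x v. ennreal (2 * x powr s * exp (- v * x\<^sup>2) * exp (- v * c\<^sup>2))
    * indicator {0<..} x * indicator {0<..} v)"
  have G: "Gamma ((1 + s) / 2) > 0" "Gamma ((1 - s) / 2) > 0"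
    using assms by (auto intro!: Gamma_real_pos)
  have inner1: "(\<integral>\<^sup>+v. F x v \<partial>lborel) = ennreal (2 * x powr s / (x\<^sup>2 + c\<^sup>2)) * indicator {0<..} x" for x
  proof (cases "x > 0")
    case True
    have "(\<integral>\<^sup>+v. F x v \<partial>lborel) = (\<integral>\<^sup>+v. ennreal (2 * x powr s) *
        (ennreal (v powr (1 - 1) * exp (- (x\<^sup>2 + c\<^sup>2) * v)) * indicator {0<..} v) \<partial>lborel)"
      using True by (intro nn_integral_cong)
        (auto simp: F_def indicator_def algebra_simps exp_add[symmetric] simp flip: ennreal_mult')
    also have "\<dots> = ennreal (2 * x powr s) * (\<integral>\<^sup>+v\<in>{0<..}. ennreal (v powr (1 - 1) * exp (- (x\<^sup>2 + c\<^sup>2) * v)) \<partial>lborel)"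
      by (rule nn_integral_cmult) measurable
    also have "\<dots> = ennreal (2 * x powr s) * ennreal (Gamma 1 * (x\<^sup>2 + c\<^sup>2) powr - 1)"
      using True assms(3) by (subst nn_integral_Gamma_scaled) (auto intro: add_pos_pos)
    also have "(x\<^sup>2 + c\<^sup>2) powr - 1 = 1 / (x\<^sup>2 + c\<^sup>2)"
      using True by (simp add: powr_minus divide_inverse add_pos_nonneg)
    finally show ?thesis using True by (simp flip: ennreal_mult')
  qed (simp add: F_def)
  have inner2: "(\<integral>\<^sup>+x. F x v \<partial>lborel) = ennreal (Gamma ((1 + s) / 2)) *
      (ennreal (v powr ((1 - s) / 2 - 1) * exp (- c\<^sup>2 * v)) * indicator {0<..} v)" for v
  proof (cases "v > 0")
    case True
    have e: "2 * ((1 + s) / 2) - 1 = s" by (simp add: field_simps)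
    have "(\<integral>\<^sup>+x. F x v \<partial>lborel) = (\<integral>\<^sup>+x. ennreal (exp (- v * c\<^sup>2)) *
        (ennreal (2 * x powr s * exp (- v * x\<^sup>2)) * indicator {0<..} x) \<partial>lborel)"
      using True by (intro nn_integral_cong) (auto simp: F_def indicator_def mult_ac simp flip: ennreal_mult')
    also have "\<dots> = ennreal (exp (- v * c\<^sup>2)) *
        (\<integral>\<^sup>+x\<in>{0<..}. ennreal (2 * x powr s * exp (- v * x\<^sup>2)) \<partial>lborel)"
      by (rule nn_integral_cmult) measurable
    also have "\<dots> = ennreal (exp (- v * c\<^sup>2)) * ennreal (Gamma ((1 + s) / 2) * v powr - ((1 + s) / 2))"
      using True assms nn_integral_Gamma_square[of "(1 + s) / 2" v, unfolded e] by simp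
    also have "- ((1 + s) / 2) = (1 - s) / 2 - 1" by (simp add: field_simps)
    finally show ?thesis using True G by (simp add: mult_ac flip: ennreal_mult')
  qed (simp add: F_def)
  have "(\<integral>\<^sup>+x\<in>{0<..}. ennreal (2 * x powr s / (x\<^sup>2 + c\<^sup>2)) \<partial>lborel) = (\<integral>\<^sup>+x. \<integral>\<^sup>+v. F x v \<partial>lborel \<partial>lborel)"
    by (simp add: inner1)
  also have "\<dots> = (\<integral>\<^sup>+v. \<integral>\<^sup>+x. F x v \<partial>lborel \<partial>lborel)"
    by (rule lborel_pair.Fubini'[symmetric]) (unfold F_def, measurable)
  also have "\<dots> = ennreal (Gamma ((1 + s) / 2)) *
      (\<integral>\<^sup>+v\<in>{0<..}. ennreal (v powr ((1 - s) / 2 - 1) * exp (- c\<^sup>2 * v)) \<partial>lborel)"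
    unfolding inner2 by (rule nn_integral_cmult) measurable
  also have "\<dots> = ennreal (Gamma ((1 + s) / 2)) * ennreal (Gamma ((1 - s) / 2) * (c\<^sup>2) powr - ((1 - s) / 2))"
    using assms by (subst nn_integral_Gamma_scaled) auto
  also have "(c\<^sup>2) powr - ((1 - s) / 2) = c powr (s - 1)"
  proof -
    have "2 * - ((1 - s) / 2) = s - 1" by (simp add: field_simps)
    then show ?thesis using assms(3) powr_powr[of c 2 "- ((1 - s) / 2)"] by simp
  qed
  finally show ?thesis using G by (simp add: mult.assoc flip: ennreal_mult')
qed

section \<open>Mellin transform through the Euler--Maclaurin kernel\<close>

lemma parabola_laplace:
  fixes x :: real
  assumes "x > 0"
  shows "((\<lambda>u. (u - real n) * (real n + 1 - u) / 2 * (x\<^sup>2 * exp (- u * x))) has_integral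
      exp (- real n * x) * ((1 + exp (- x)) / 2 - (1 - exp (- x)) / x)) {real n..real n + 1}"
proof -
  have "((\<lambda>u. ((u - real n) * (real n + 1 - u) / 2) *\<^sub>R (x\<^sup>2 * exp (- u * x))) has_integral
      (1 / 2) *\<^sub>R (exp (- real n * x) + exp (- (real n + 1) * x))
      - (- exp (- (real n + 1) * x) / x - (- exp (- real n * x) / x))) {real n..real n + 1}"
    using assms
    by (intro integral_parabola_second_deriv[where g' = "\<lambda>u. - x * exp (- u * x)"])
       (auto intro!: continuous_intros derivative_eq_intros
         simp: power2_eq_square simp flip: has_real_derivative_iff_has_vector_derivative)
  also have "exp (- (real n + 1) * x) = exp (- real n * x) * exp (- x)"
    by (simp add: algebra_simps flip: exp_add)
  also have "(1 / 2) *\<^sub>R (exp (- real n * x) + exp (- real n * x) * exp (- x))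
      - (- (exp (- real n * x) * exp (- x)) / x - (- exp (- real n * x) / x)) =
      exp (- real n * x) * ((1 + exp (- x)) / 2 - (1 - exp (- x)) / x)"
    using assms by (simp add: field_simps)
  finally show ?thesis by simp
qed

text \<open>A geometric series in \<open>exp (- x)\<close>. Together with
  \<open>parabola_laplace\<close> it represents the kernel as \<open>x\<^sup>2\<close> times the
  Laplace transform of the periodically continued parabola.\<close>

lemma parabola_laplace_sums:
  fixes x :: real
  assumes "x > 0"
  shows "(\<lambda>n. exp (- real n * x) * ((1 + exp (- x)) / 2 - (1 - exp (- x)) / x)) sums
      (1 / (exp x - 1) - 1 / x + 1 / 2)"
proof -
  have "(\<lambda>n. exp (- x) ^ n) sums (1 / (1 - exp (- x)))"
    using assms by (intro geometric_sums) auto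
  from sums_mult2[OF this, of "(1 + exp (- x)) / 2 - (1 - exp (- x)) / x"]
  have "(\<lambda>n. exp (- x) ^ n * ((1 + exp (- x)) / 2 - (1 - exp (- x)) / x)) sums
      (1 / (1 - exp (- x)) * ((1 + exp (- x)) / 2 - (1 - exp (- x)) / x))" .
  moreover have "exp (- x) ^ n = exp (- real n * x)" for n
    by (simp flip: exp_of_nat_mult)
  moreover have "1 / (1 - exp (- x)) * ((1 + exp (- x)) / 2 - (1 - exp (- x)) / x) = 1 / (exp x - 1) - 1 / x + 1 / 2"
  proof -
    have e: "exp (- x) = 1 / exp x" "exp x > 1" using assms by (auto simp: exp_minus field_simps)
    have *: "1 - 1 / E \<noteq> 0" "1 / (1 - 1 / E) * ((1 + 1 / E) / 2) = 1 / (E - 1) + 1 / 2" if "E > 1" for E :: real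
      using that by (auto simp: field_simps)
    have "1 / (1 - 1 / exp x) * ((1 - 1 / exp x) / x) = 1 / x"
      using *(1)[OF e(2)] by (metis divide_divide_eq_left' divide_self mult.commute times_divide_eq_left mult_1)
    with *(2)[OF e(2)] show ?thesis unfolding e(1) right_diff_distrib by linarith
  qed
  ultimately show ?thesis by simp
qed

text \<open>Exchanging the integrals leaves, for fixed \<open>u\<close>, the Gamma integral
  \<open>Gamma (s + 2) * u powr (- s - 2)\<close>; integrating this against the parabola gives
  \<open>I\<close>.\<close>

lemma nn_integral_mellin_parabola:
  fixes s :: real
  assumes s: "s > - 2"
    and I: "((\<lambda>u. (u - real n) * (real n + 1 - u) / 2 * u powr (- s - 2)) has_integral I) {real n..real n + 1}"
  shows "(\<integral>\<^sup>+x\<in>{0<..}. ennreal (x powr (s - 1) *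
      (exp (- real n * x) * ((1 + exp (- x)) / 2 - (1 - exp (- x)) / x))) \<partial>lborel) = ennreal (Gamma (s + 2) * I)"
proof -
  define p where "p = (\<lambda>u. (u - real n) * (real n + 1 - u) / 2)"
  define b where "b = (\<lambda>x. exp (- real n * x) * ((1 + exp (- x)) / 2 - (1 - exp (- x)) / x))"
  define F where "F = (\<lambda>x u. ennreal (x powr (s - 1)) * (ennreal (p u * (x\<^sup>2 * exp (- u * x)))
    * indicator {real n..real n + 1} u) * indicator {0<..} x)"
  have p0: "p u \<ge> 0" if "u \<in> {real n..real n + 1}" for u using that by (auto simp: p_def)
  have [measurable]: "p \<in> borel_measurable borel" unfolding p_def by measurable
  have G: "Gamma (s + 2) > 0" using s by (intro Gamma_real_pos) auto
  have inner1: "(\<integral>\<^sup>+u. F x u \<partial>lborel) = ennreal (x powr (s - 1) * b x) * indicator {0<..} x" for x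
  proof (cases "x > 0")
    case True
    have h: "((\<lambda>u. p u * (x\<^sup>2 * exp (- u * x))) has_integral b x) {real n..real n + 1}"
      unfolding p_def b_def by (rule parabola_laplace[OF True])
    have "(\<integral>\<^sup>+u. F x u \<partial>lborel) = ennreal (x powr (s - 1)) *
        (\<integral>\<^sup>+u\<in>{real n..real n + 1}. ennreal (p u * (x\<^sup>2 * exp (- u * x))) \<partial>lborel)"
      unfolding F_def using True by (simp add: nn_integral_cmult)
    also have "\<dots> = ennreal (x powr (s - 1)) * ennreal (b x)"
      using nn_integral_has_integral_lebesgue'[OF _ h] p0 by simp
    finally show ?thesis using True by (simp flip: ennreal_mult')
  qed (simp add: F_def)
  have inner2: "(\<integral>\<^sup>+x. F x u \<partial>lborel) = ennreal (Gamma (s + 2)) *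
      (ennreal (p u * u powr (- s - 2)) * indicator {real n..real n + 1} u)" for u
  proof (cases "u \<in> {real n..real n + 1} \<and> u > 0")
    case True
    then have pu: "p u \<ge> 0" using p0 by simp
    have e: "x powr (s - 1) * x\<^sup>2 = x powr (s + 2 - 1)" if "x > 0" for x
      using that powr_add[of x "s - 1" 2] by simp
    have "(\<integral>\<^sup>+x. F x u \<partial>lborel) = (\<integral>\<^sup>+x. ennreal (p u) *
        (ennreal (x powr (s + 2 - 1) * exp (- u * x)) * indicator {0<..} x) \<partial>lborel)"
    proof (rule nn_integral_cong)
      fix x :: real
      have "x powr (s - 1) * (p u * (x\<^sup>2 * exp (- u * x))) = p u * ((x powr (s - 1) * x\<^sup>2) * exp (- u * x))"
        by (simp add: mult_ac)
      then show "F x u = ennreal (p u) * (ennreal (x powr (s + 2 - 1) * exp (- u * x)) * indicator {0<..} x)"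
        using True pu e[of x] by (auto simp: F_def indicator_def simp flip: ennreal_mult' ennreal_mult'')
    qed
    also have "\<dots> = ennreal (p u) * (\<integral>\<^sup>+x\<in>{0<..}. ennreal (x powr (s + 2 - 1) * exp (- u * x)) \<partial>lborel)"
      by (rule nn_integral_cmult) measurable
    also have "\<dots> = ennreal (p u) * ennreal (Gamma (s + 2) * u powr - (s + 2))"
      using True s by (subst nn_integral_Gamma_scaled) auto
    also have "- (s + 2) = - s - 2" by simp
    finally show ?thesis using True pu G by (simp add: mult_ac flip: ennreal_mult' ennreal_mult'')
  next
    case False
    show ?thesis
    proof (cases "u \<in> {real n..real n + 1}")
      case True
      \<comment> \<open>The left end of the first interval is the only point where the Gamma
        integral does not apply; the parabola vanishes there, so both sides are 0.\<close>
      with False have "u = 0" "n = 0" by auto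
      then show ?thesis by (simp add: F_def p_def)
    qed (simp add: F_def)
  qed
  have "(\<integral>\<^sup>+x\<in>{0<..}. ennreal (x powr (s - 1) * b x) \<partial>lborel) = (\<integral>\<^sup>+x. \<integral>\<^sup>+u. F x u \<partial>lborel \<partial>lborel)"
    by (simp add: inner1)
  also have "\<dots> = (\<integral>\<^sup>+u. \<integral>\<^sup>+x. F x u \<partial>lborel \<partial>lborel)"
    by (rule lborel_pair.Fubini'[symmetric]) (unfold F_def, measurable)
  also have "\<dots> = ennreal (Gamma (s + 2)) *
      (\<integral>\<^sup>+u\<in>{real n..real n + 1}. ennreal (p u * u powr (- s - 2)) \<partial>lborel)"
    unfolding inner2 by (rule nn_integral_cmult) measurable
  also have "\<dots> = ennreal (Gamma (s + 2)) * ennreal I"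
    using nn_integral_has_integral_lebesgue'[OF _ I[folded p_def]] p0 by (simp add: p_def)
  finally show ?thesis using G by (simp add: b_def flip: ennreal_mult')
qed

text \<open>For s < 0 the Euler--Maclaurin integral can be started at 0 instead of 1: the integrand
  is of order \<open>u powr (- s - 1)\<close> at 0, and the integral over [0, 1] is exactly what
  absorbs the boundary terms of \<open>zeta_euler_maclaurin\<close>. The index is shifted by one,
  since \<open>em_term n\<close> belongs to the interval from n + 1 to n + 2.\<close>

lemma zeta_real_parabola:
  fixes s :: real
  assumes s: "-1 < s" "s < 0"
  obtains I where
    "\<And>n. ((\<lambda>u. (u - real n) * (real n + 1 - u) / 2 * u powr (- s - 2)) has_integral I n) {real n..real n + 1}"
    "(\<lambda>n. complex_of_real (I n)) sums (zeta (of_real s) / of_real (s * (s + 1)))"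
proof -
  define E where "E = (\<lambda>n. (real (Suc n) powr - s + real (Suc (Suc n)) powr - s) / 2
     + (real (Suc (Suc n)) powr (1 - s) - real (Suc n) powr (1 - s)) / (s - 1))"
  define I where "I = (\<lambda>n. if n = 0 then - 1 / (2 * s * (1 - s)) else E (n - 1) / (s * (s + 1)))"
  have int0: "((\<lambda>u. (u - real 0) * (real 0 + 1 - u) / 2 * u powr (- s - 2)) has_integral I 0) {real 0..real 0 + 1}"
  proof -
    \<comment> \<open>On [0, 1] the function \<open>u powr - s\<close> has a singular derivative at
      0, so an explicit antiderivative is used; its exponents \<open>- s\<close> and
      \<open>1 - s\<close> are positive, which makes it continuous at 0.\<close>
    define H where "H = (\<lambda>u. (u powr - s / - s - u powr (1 - s) / (1 - s)) / 2)"
    have "((\<lambda>u. (u - 0) * (1 - u) / 2 * u powr (- s - 2)) has_integral (H 1 - H 0)) {0..1}"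
    proof (rule fundamental_theorem_of_calculus_interior)
      show "continuous_on {0..1} H"
        unfolding H_def using s by (auto intro!: continuous_intros continuous_on_powr')
      fix u :: real assume "u \<in> {0<..<1}"
      then have u: "u > 0" by simp
      have "u powr (- s - 1) = u * u powr (- s - 2)" "u powr - s = u * (u * u powr (- s - 2))"
        using u powr_add[of u 1 "- s - 2"] powr_add[of u 1 "- s - 1"] by (simp_all add: minus_diff_commute)
      moreover have "(H has_real_derivative (u powr (- s - 1) - u powr - s) / 2) (at u)"
      proof -
        have "(H has_real_derivative ((- s * u powr (- s - 1)) / - s - ((1 - s) * u powr (1 - s - 1)) / (1 - s)) / 2) (at u)"
          unfolding H_def by (intro DERIV_cdivide DERIV_diff has_real_derivative_powr u)
        then show ?thesis using s by simp
      qed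
      ultimately show "(H has_vector_derivative (u - 0) * (1 - u) / 2 * u powr (- s - 2)) (at u)"
        by (simp add: algebra_simps diff_divide_distrib flip: has_real_derivative_iff_has_vector_derivative)
    qed simp
    also have "H 1 - H 0 = I 0" using s by (simp add: H_def I_def field_simps)
    finally show ?thesis by simp
  qed
  have intS: "((\<lambda>u. (u - real (Suc n)) * (real (Suc n) + 1 - u) / 2 * u powr (- s - 2)) has_integral I (Suc n))
      {real (Suc n)..real (Suc n) + 1}" for n
  proof -
    let ?a = "real (Suc n)"
    have ss: "s * (s + 1) \<noteq> 0" using s by auto
    have "((\<lambda>u. ((u - ?a) * (?a + 1 - u) / 2) *\<^sub>R (s * (s + 1) * u powr (- s - 2))) has_integral
      (1 / 2) *\<^sub>R (?a powr - s + (?a + 1) powr - s)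
      - ((?a + 1) powr (1 - s) / (1 - s) - ?a powr (1 - s) / (1 - s))) {?a..?a + 1}"
    proof (rule integral_parabola_second_deriv[where g' = "\<lambda>u. - s * u powr (- s - 1)"])
      show "continuous_on {?a..?a + 1} (\<lambda>u. ((u - ?a) * (?a + 1 - u) / 2) *\<^sub>R (- s * u powr (- s - 1)))"
        "continuous_on {?a..?a + 1} (\<lambda>u. u powr - s)"
        "continuous_on {?a..?a + 1} (\<lambda>u. u powr (1 - s) / (1 - s))"
        using s by (auto intro!: continuous_intros)
      fix u assume u: "u \<in> {?a<..<?a + 1}"
      then have u0: "u > 0" by (simp add: less_trans[of 0 ?a])
      show "((\<lambda>u. u powr - s) has_vector_derivative - s * u powr (- s - 1)) (at u)"
        unfolding has_real_derivative_iff_has_vector_derivative[symmetric]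
        using has_real_derivative_powr[OF u0, of "- s"] by simp
      show "((\<lambda>u. - s * u powr (- s - 1)) has_vector_derivative s * (s + 1) * u powr (- s - 2)) (at u)"
        unfolding has_real_derivative_iff_has_vector_derivative[symmetric]
        using DERIV_cmult[OF has_real_derivative_powr[OF u0, of "- s - 1"], of "- s"]
        by (simp add: algebra_simps)
      show "((\<lambda>u. u powr (1 - s) / (1 - s)) has_vector_derivative u powr - s) (at u)"
        unfolding has_real_derivative_iff_has_vector_derivative[symmetric]
        using DERIV_cdivide[OF has_real_derivative_powr[OF u0, of "1 - s"], of "1 - s"] s by simp
    qed
    also have "(1 / 2) *\<^sub>R (?a powr - s + (?a + 1) powr - s)
      - ((?a + 1) powr (1 - s) / (1 - s) - ?a powr (1 - s) / (1 - s)) = E n"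
    proof -
      have a1: "?a + 1 = real (Suc (Suc n))" by simp
      have "(1 / 2) *\<^sub>R (x + y) - (p / (1 - s) - q / (1 - s)) = (x + y) / 2 + (p - q) / (s - 1)" for x y p q :: real
        using minus_divide_right[of "p - q" "s - 1"] by (simp add: diff_divide_distrib)
      then show ?thesis unfolding E_def a1 .
    qed
    finally have "((\<lambda>u. (u - ?a) * (?a + 1 - u) / 2 * (s * (s + 1) * u powr (- s - 2))) has_integral E n) {?a..?a + 1}"
      by simp
    from has_integral_divide[OF this, of "s * (s + 1)"]
    have "((\<lambda>u. (u - ?a) * (?a + 1 - u) / 2 * (s * (s + 1) * u powr (- s - 2)) / (s * (s + 1))) has_integral I (Suc n)) {?a..?a + 1}"
      by (simp add: I_def del: of_nat_Suc)
    moreover have "w * (s * (s + 1) * v) / (s * (s + 1)) = w * v" for w v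
      using ss by (metis mult.left_commute nonzero_mult_div_cancel_left)
    ultimately show ?thesis by (simp only:)
  qed
  have "(\<lambda>n. complex_of_real (I n)) sums (zeta (of_real s) / of_real (s * (s + 1)))"
  proof -
    let ?s = "complex_of_real s"
    have s1: "?s \<noteq> 1" using s by auto
    have em: "em_term n ?s = of_real (E n) * (?s - 1)" for n
    proof -
      have "E n * (s - 1) = (s - 1) * (real (Suc n) powr - s + real (Suc (Suc n)) powr - s) / 2
         + (real (Suc (Suc n)) powr (1 - s) - real (Suc n) powr (1 - s))"
        using s unfolding E_def by (simp add: distrib_left distrib_right mult_ac del: of_nat_Suc)
      moreover have "of_nat (Suc k) powr z = complex_of_real (real (Suc k) powr w)" if "z = of_real w" for k z w
        using powr_of_real[of "real (Suc k)" w] that by simp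
      from this[of "- ?s" "- s"] this[of "1 - ?s" "1 - s"]
      have "em_term n ?s = of_real ((s - 1) * (real (Suc n) powr - s + real (Suc (Suc n)) powr - s) / 2
         + (real (Suc (Suc n)) powr (1 - s) - real (Suc n) powr (1 - s)))"
        unfolding em_term_def by (simp del: of_nat_Suc)
      ultimately show ?thesis by (metis of_real_1 of_real_diff of_real_mult)
    qed
    have "(\<lambda>n. em_term n ?s) sums ((?s - 1) * zeta ?s - (1 + (?s - 1) / 2))"
      using summable_sums[OF summable_em_term[of ?s]] zeta_euler_maclaurin[of ?s] s s1 by simp
    from sums_divide[OF this, of "(?s - 1) * (?s * (?s + 1))"]
    have "(\<lambda>n. complex_of_real (I (Suc n))) sums
        (((?s - 1) * zeta ?s - (1 + (?s - 1) / 2)) / ((?s - 1) * (?s * (?s + 1))))"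
      using s1 by (simp add: em I_def)
    then have "(\<lambda>n. complex_of_real (I n)) sums
        (((?s - 1) * zeta ?s - (1 + (?s - 1) / 2)) / ((?s - 1) * (?s * (?s + 1))) + of_real (I 0))"
      by (rule sums_Suc)
    moreover have "((?s - 1) * zeta ?s - (1 + (?s - 1) / 2)) / ((?s - 1) * (?s * (?s + 1))) + of_real (I 0)
        = zeta ?s / of_real (s * (s + 1))"
    proof -
      have nz: "?s \<noteq> 0" "?s + 1 \<noteq> 0" "?s - 1 \<noteq> 0"
        using s by (auto simp: complex_eq_iff)
      have I0: "of_real (I 0) = (1 + (?s - 1) / 2) / ((?s - 1) * (?s * (?s + 1)))"
      proof -
        have "I 0 = (1 + (s - 1) / 2) / ((s - 1) * (s * (s + 1)))"
          using s by (simp add: I_def divide_simps) (simp add: algebra_simps)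
        then show ?thesis by simp
      qed
      show ?thesis unfolding I0 using nz by (simp add: diff_divide_distrib)
    qed
    ultimately show ?thesis by simp
  qed
  moreover have "((\<lambda>u. (u - real n) * (real n + 1 - u) / 2 * u powr (- s - 2)) has_integral I n) {real n..real n + 1}" for n
    using int0 intS[of "n - 1"] by (cases n) auto
  ultimately show ?thesis by (intro that)
qed

section \<open>The functional equation, on a real segment and then in the plane\<close>

lemma zeta_functional_real:
  fixes s :: real
  assumes s: "-1 < s" "s < 0"
  shows "of_real (Gamma (s + 2)) * (zeta (of_real s) / of_real (s * (s + 1))) =
     of_real (Gamma ((1 + s) / 2) * Gamma ((1 - s) / 2) * (2 * pi) powr (s - 1)) * zeta (1 - of_real s)"
proof -
  obtain I where I:
    "\<And>n. ((\<lambda>u. (u - real n) * (real n + 1 - u) / 2 * u powr (- s - 2)) has_integral I n) {real n..real n + 1}"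
    and I_sums: "(\<lambda>n. complex_of_real (I n)) sums (zeta (of_real s) / of_real (s * (s + 1)))"
    using zeta_real_parabola[OF s] by blast
  \<comment> \<open>The nonnegative integrals compare reals, so both zeta values are first replaced
    by their real parts and shown to be real, as sums of real series.\<close>
  define J where "J = Re (zeta (of_real s) / of_real (s * (s + 1)))"
  have J: "I sums J" using sums_Re[OF I_sums] by (simp add: J_def)
  have J': "zeta (of_real s) / of_real (s * (s + 1)) = of_real J"
    using I_sums sums_of_real[OF J] by (rule sums_unique2)
  \<comment> \<open>\<open>ennreal\<close> maps negative reals to 0; nonnegativity of all terms and
    of both totals is what allows the final identity to be read back in the reals.\<close>
  have I0: "I n \<ge> 0" for n by (rule has_integral_nonneg[OF I]) auto
  have "of_nat (Suc n) powr - (1 - of_real s) = complex_of_real (real (Suc n) powr (s - 1))" for n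
    using powr_of_real[of "real (Suc n)" "s - 1"] by simp
  then have Z_sums: "(\<lambda>n. complex_of_real (real (Suc n) powr (s - 1))) sums zeta (1 - of_real s)"
    using zeta_sums[of "1 - of_real s"] s by simp
  define Z where "Z = Re (zeta (1 - of_real s))"
  have Z: "(\<lambda>n. real (Suc n) powr (s - 1)) sums Z" using sums_Re[OF Z_sums] by (simp add: Z_def)
  have Z': "zeta (1 - of_real s) = of_real Z"
    using Z_sums sums_of_real[OF Z] by (rule sums_unique2)
  have Z0: "Z \<ge> 0" using Z by (rule sums_le[OF _ sums_zero, rotated]) auto
  have J0: "J \<ge> 0" using J by (rule sums_le[OF _ sums_zero, rotated]) (use I0 in auto)
  have G: "Gamma (s + 2) > 0" "Gamma ((1 + s) / 2) > 0" "Gamma ((1 - s) / 2) > 0"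
    using s by (auto intro!: Gamma_real_pos)
  define b where "b = (\<lambda>n x. exp (- real n * x) * ((1 + exp (- x)) / 2 - (1 - exp (- x)) / x))"
  define c where "c = (\<lambda>k. 2 * pi * (real k + 1))"
  have b0: "b n x \<ge> 0" if "x > 0" for n x
    unfolding b_def by (rule has_integral_nonneg[OF parabola_laplace[OF that]]) auto
  define \<Phi> where "\<Phi> = (\<lambda>x::real. 1 / (exp x - 1) - 1 / x + 1 / 2)"
  have "(\<integral>\<^sup>+x\<in>{0<..}. ennreal (x powr (s - 1) * \<Phi> x) \<partial>lborel) =
      (\<integral>\<^sup>+x. (\<Sum>n. ennreal (x powr (s - 1) * b n x) * indicator {0<..} x) \<partial>lborel)"
  proof (rule nn_integral_cong)
    fix x :: real
    have "(\<Sum>n. ennreal (x powr (s - 1) * b n x)) = ennreal (x powr (s - 1) * \<Phi> x)" if "x > 0"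
      unfolding \<Phi>_def using b0[OF that]
      using parabola_laplace_sums[OF that] by (intro suminf_ennreal_eq sums_mult) (simp_all add: b_def)
    then show "ennreal (x powr (s - 1) * \<Phi> x) * indicator {0<..} x =
        (\<Sum>n. ennreal (x powr (s - 1) * b n x) * indicator {0<..} x)"
      by (auto simp: indicator_def)
  qed
  also have "\<dots> = (\<Sum>n. \<integral>\<^sup>+x\<in>{0<..}. ennreal (x powr (s - 1) * b n x) \<partial>lborel)"
    by (rule nn_integral_suminf) (unfold b_def, measurable)
  also have "\<dots> = (\<Sum>n. ennreal (Gamma (s + 2) * I n))"
    unfolding b_def using s by (subst nn_integral_mellin_parabola[OF _ I]) auto
  also have "\<dots> = ennreal (Gamma (s + 2) * J)"
    using G I0 by (intro suminf_ennreal_eq sums_mult J) auto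
  finally have eq1: "(\<integral>\<^sup>+x\<in>{0<..}. ennreal (x powr (s - 1) * \<Phi> x) \<partial>lborel) = ennreal (Gamma (s + 2) * J)" .
  have "(\<integral>\<^sup>+x\<in>{0<..}. ennreal (x powr (s - 1) * \<Phi> x) \<partial>lborel) =
      (\<integral>\<^sup>+x. (\<Sum>k. ennreal (2 * x powr s / (x\<^sup>2 + (c k)\<^sup>2)) * indicator {0<..} x) \<partial>lborel)"
  proof (rule nn_integral_cong)
    fix x :: real
    have "(\<Sum>k. ennreal (2 * x powr s / (x\<^sup>2 + (c k)\<^sup>2))) = ennreal (x powr (s - 1) * \<Phi> x)" if "x > 0"
    proof (rule suminf_ennreal_eq)
      have "x powr s = x powr (s - 1) * x" using that powr_add[of x "s - 1" 1] by simp
      then have "2 * x powr s / (x\<^sup>2 + (c k)\<^sup>2) = x powr (s - 1) * (2 * x / (x\<^sup>2 + (c k)\<^sup>2))" for k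
        by simp
      then show "(\<lambda>k. 2 * x powr s / (x\<^sup>2 + (c k)\<^sup>2)) sums (x powr (s - 1) * \<Phi> x)"
        unfolding \<Phi>_def c_def
        by (simp only:) (rule sums_mult[OF planck_kernel_partial_fractions[OF that]])
    qed simp
    moreover have "indicator {0<..} x = (if x > 0 then 1 else 0 :: ennreal)" by simp
    ultimately show "ennreal (x powr (s - 1) * \<Phi> x) * indicator {0<..} x =
        (\<Sum>k. ennreal (2 * x powr s / (x\<^sup>2 + (c k)\<^sup>2)) * indicator {0<..} x)"
      by (cases "x > 0") (simp_all only: if_True if_False mult_1_right mult_zero_right suminf_zero)
  qed
  also have "\<dots> = (\<Sum>k. \<integral>\<^sup>+x\<in>{0<..}. ennreal (2 * x powr s / (x\<^sup>2 + (c k)\<^sup>2)) \<partial>lborel)"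
    by (rule nn_integral_suminf) measurable
  also have "\<dots> = (\<Sum>k. ennreal (Gamma ((1 + s) / 2) * Gamma ((1 - s) / 2) * c k powr (s - 1)))"
    using s by (subst nn_integral_mellin_kernel) (auto simp: c_def)
  also have "\<dots> = ennreal (Gamma ((1 + s) / 2) * Gamma ((1 - s) / 2) * ((2 * pi) powr (s - 1) * Z))"
  proof (intro suminf_ennreal_eq sums_mult)
    have "c k powr (s - 1) = (2 * pi) powr (s - 1) * real (Suc k) powr (s - 1)" for k
      unfolding c_def by (subst powr_mult) (auto simp: add.commute)
    then show "(\<lambda>k. c k powr (s - 1)) sums ((2 * pi) powr (s - 1) * Z)"
      using sums_mult[OF Z] by simp
  qed (use G in auto)
  finally have "ennreal (Gamma (s + 2) * J) =
      ennreal (Gamma ((1 + s) / 2) * Gamma ((1 - s) / 2) * ((2 * pi) powr (s - 1) * Z))"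
    unfolding eq1 .
  then have "Gamma (s + 2) * J = Gamma ((1 + s) / 2) * Gamma ((1 - s) / 2) * ((2 * pi) powr (s - 1) * Z)"
    using G J0 Z0 by (subst (asm) ennreal_inj) auto
  then show ?thesis unfolding J' Z' by (simp only: mult.assoc flip: of_real_mult)
qed

text \<open>The cosine and \<open>rGamma\<close> are kept as multipliers, so that both sides are
  holomorphic off 0 and 1. The real segment from -1 to 0, where the identity is known, accumulates
  at -1/2, and the identity theorem does the rest.\<close>

lemma zeta_functional_equation:
  assumes "s \<noteq> 0" "s \<noteq> 1"
  shows "zeta s * (2 * cos (of_real pi * s / 2)) = of_real (2 * pi) powr s * zeta (1 - s) * rGamma s"
proof -
  define f where "f = (\<lambda>s. zeta s * (2 * cos (of_real pi * s / 2)) - of_real (2 * pi) powr s * zeta (1 - s) * rGamma s)"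
  define U where "U = complex_of_real ` {-1<..<0}"
  have "f s = 0"
  proof (rule analytic_continuation[of f "- {0, 1}" U "of_real (- (1 / 2))"])
    have "(\<lambda>s. zeta (1 - s)) holomorphic_on - {0, 1}"
      by (rule holomorphic_on_compose_gen[OF _ zeta_holomorphic, unfolded o_def]) (auto intro!: holomorphic_intros)
    then show "f holomorphic_on - {0, 1}"
      unfolding f_def
      by (intro holomorphic_intros holomorphic_on_subset[OF zeta_holomorphic]) auto
    have "connected (- {0::complex} - {1})"
      by (intro connected_open_delete connected_punctured_universe) auto
    moreover have "- {0::complex} - {1} = - {0, 1}" by auto
    ultimately show "connected (- {0, 1::complex})" by simp
    show "of_real (- (1 / 2)) islimpt U"
      unfolding islimpt_approachable
    proof safe
      fix e :: real assume e: "e > 0"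
      define t where "t = - (1 / 2) + min (1 / 4) (e / 2)"
      have "t \<in> {-1<..<0}" "t \<noteq> - (1 / 2)" "\<bar>t - - (1 / 2)\<bar> < e"
        using e by (auto simp: t_def min_def)
      then show "\<exists>x'\<in>U. x' \<noteq> of_real (- (1 / 2)) \<and> dist x' (of_real (- (1 / 2))) < e"
        unfolding U_def by (intro bexI[of _ "of_real t"]) (auto simp: dist_of_real dist_real_def simp del: of_real_minus of_real_divide)
    qed
    fix z assume "z \<in> U"
    then obtain x where x: "z = of_real x" "-1 < x" "x < 0" by (auto simp: U_def)
    have c0: "cos (of_real pi * z / 2) \<noteq> 0"
    proof -
      have "cos (pi * x / 2) > 0" using x mult_strict_left_mono[of "-1" x pi] mult_strict_left_mono[of x 0 pi]
        by (intro cos_gt_zero_pi) (auto simp: field_simps)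
      moreover have "cos (of_real pi * z / 2) = of_real (cos (pi * x / 2))"
        unfolding x by (simp flip: cos_of_real)
      ultimately show ?thesis by simp
    qed
    have "Gamma ((1 + z) / 2) * Gamma ((1 - z) / 2) = of_real pi / sin (of_real pi * ((1 + z) / 2))"
      using Gamma_reflection_complex[of "(1 + z) / 2"] by (simp add: field_simps)
    also have "of_real pi * ((1 + z) / 2) = of_real pi / 2 + of_real pi * z / 2" by (simp add: field_simps)
    also have "sin \<dots> = cos (of_real pi * z / 2)" by (simp add: sin_add)
    finally have G: "Gamma ((1 + z) / 2) * Gamma ((1 - z) / 2) = of_real pi / cos (of_real pi * z / 2)" .
    have zi: "z \<notin> \<int>\<^sub>\<le>\<^sub>0" "z + 1 \<notin> \<int>\<^sub>\<le>\<^sub>0"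
      using x by (auto elim!: nonpos_Ints_cases simp: complex_eq_iff)
    have z0: "z \<noteq> 0" "z + 1 \<noteq> 0" using x by (auto simp: complex_eq_iff)
    have "Gamma (z + 2) = (z + 1) * (z * Gamma z)"
      using Gamma_plus1[OF zi(1)] Gamma_plus1[OF zi(2)] by (simp add: add.assoc)
    moreover have "Gamma (z + 2) = of_real (Gamma (x + 2))"
      unfolding x by (simp flip: Gamma_complex_of_real)
    ultimately have e: "of_real (Gamma (x + 2)) = (z + 1) * (z * Gamma z)" by simp
    have "of_real (Gamma (x + 2)) * (zeta z / of_real (x * (x + 1))) = Gamma z * zeta z"
    proof -
      have "(w + 1) * (w * g) * (y / (w * (w + 1))) = g * y" if "w \<noteq> 0" "w + 1 \<noteq> 0" for w g y :: complex
        using that by simp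
      then show ?thesis unfolding e using z0 by (simp add: x)
    qed
    then have "Gamma z * zeta z = of_real (Gamma ((1 + x) / 2)) * of_real (Gamma ((1 - x) / 2)) * of_real ((2 * pi) powr (x - 1)) * zeta (1 - z)"
      using zeta_functional_real[OF x(2,3)] by (simp add: x)
    also have "complex_of_real (Gamma ((1 + x) / 2)) * of_real (Gamma ((1 - x) / 2)) = of_real pi / cos (of_real pi * z / 2)"
      using G unfolding x by (simp flip: Gamma_complex_of_real)
    also have "complex_of_real ((2 * pi) powr (x - 1)) = of_real (2 * pi) powr z / of_real (2 * pi)"
    proof -
      have "(2 * pi) powr (x - 1) = (2 * pi) powr x / (2 * pi)" by (simp add: powr_diff)
      moreover have "complex_of_real ((2 * pi) powr x) = of_real (2 * pi) powr z"
        unfolding x using powr_of_real[of "2 * pi" x] by simp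
      ultimately show ?thesis by simp
    qed
    finally have FE: "Gamma z * zeta z * (2 * cos (of_real pi * z / 2)) = of_real (2 * pi) powr z * zeta (1 - z)"
      using c0 by (simp add: field_simps)
    have "(rGamma z * Gamma z) * (zeta z * (2 * cos (of_real pi * z / 2))) =
        rGamma z * (Gamma z * zeta z * (2 * cos (of_real pi * z / 2)))"
      by (simp only: mult_ac)
    also have "\<dots> = of_real (2 * pi) powr z * zeta (1 - z) * rGamma z"
      unfolding FE by (simp only: mult_ac)
    finally have "(rGamma z * Gamma z) * (zeta z * (2 * cos (of_real pi * z / 2))) =
        of_real (2 * pi) powr z * zeta (1 - z) * rGamma z" .
    moreover have "rGamma z * Gamma z = 1"
      using zi by (simp add: Gamma_def rGamma_eq_zero_iff)
    ultimately show "f z = 0"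
      unfolding f_def by (simp only: mult_1 diff_self)
  qed (use assms in \<open>auto simp: U_def open_Compl finite_imp_closed complex_eq_iff\<close>)
  then show ?thesis by (simp add: f_def)
qed

section \<open>Size of zeta for Re s \<ge> 2 and its modulus on Re s = -1/2\<close>

lemma norm_zeta_minus_1_le:
  assumes "Re s \<ge> 2"
  shows "norm (zeta s - 1) \<le> 3 / 4"
proof -
  \<comment> \<open>Index \<open>n\<close> stands for the summand of n + 2. A telescoping majorant
    of all inverse squares from 2 on would add up to 1; keeping 1/4 exact and telescoping only from
    3 on gives 1/4 + 1/2 < 1, which keeps zeta away from 0.\<close>
  define h where "h = (\<lambda>n. if n = 0 then 1 / 4 else 1 / real (Suc n) - 1 / real (Suc (Suc n)))"
  have "(\<lambda>n. 1 / real (Suc (Suc n)) - 1 / real (Suc (Suc (Suc n)))) sums (1 / real (Suc (Suc 0)) - 0)"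
    by (intro telescope_sums') real_asymp
  then have "(\<lambda>n. h (Suc n)) sums (1 / 2)" by (simp add: h_def)
  then have h: "h sums (3 / 4)" by (subst (asm) sums_Suc_iff) (simp add: h_def)
  have z: "(\<lambda>n. of_nat (Suc n) powr - s) sums zeta s" using assms by (intro zeta_sums) auto
  then have z': "(\<lambda>n. of_nat (Suc (Suc n)) powr - s) sums (zeta s - 1)"
    by (subst sums_Suc_iff) simp
  have "norm (of_nat (Suc (Suc n)) powr - s :: complex) \<le> h n" for n
  proof -
    have "norm (of_nat (Suc (Suc n)) powr - s :: complex) = real (Suc (Suc n)) powr - Re s"
      using norm_Suc_powr[of "Suc n" "- s"] by simp
    also have "\<dots> \<le> real (Suc (Suc n)) powr - 2"
      using assms by (intro powr_mono) auto
    also have "\<dots> = 1 / real (Suc (Suc n)) ^ 2"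
      by (simp add: powr_minus divide_inverse)
    also have "\<dots> \<le> h n"
    proof (cases n)
      case 0
      then show ?thesis by (simp add: h_def)
    next
      case (Suc m)
      then show ?thesis
        by (simp add: h_def divide_simps power2_eq_square)
    qed
    finally show ?thesis .
  qed
  then have "norm (\<Sum>n. of_nat (Suc (Suc n)) powr - s :: complex) \<le> suminf h"
    using sums_summable[OF h] by (intro norm_suminf_le) auto
  then show ?thesis using z' h by (simp add: sums_iff)
qed

lemma norm_zeta_bounds:
  assumes "Re s \<ge> 2"
  shows "1 / 4 \<le> norm (zeta s)" "norm (zeta s) \<le> 2"
  using norm_zeta_minus_1_le[OF assms] norm_triangle_ineq2[of 1 "1 - zeta s"] norm_triangle_ineq2[of "zeta s" 1]
  by (auto simp: norm_minus_commute)

lemma zeta_cnj: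
  assumes "Re s > 1"
  shows "zeta (cnj s) = cnj (zeta s)"
proof -
  have "(\<lambda>n. cnj (of_nat (Suc n) powr - s)) sums cnj (zeta s)"
    using zeta_sums[OF assms] by (simp only: sums_cnj)
  moreover have "cnj (of_nat (Suc n) powr - s) = of_nat (Suc n) powr - cnj s" for n
    by (subst cnj_powr) auto
  ultimately have "(\<lambda>n. of_nat (Suc n) powr - cnj s) sums cnj (zeta s)" by simp
  with zeta_sums[of "cnj s"] assms show ?thesis by (simp add: sums_unique2)
qed

text \<open>Since -s is the conjugate of s + 1, the product in the reflection formula is a squared
  modulus, so it determines \<open>norm (rGamma (s + 1))\<close>. The sine in it splits into two
  factors of equal modulus, and the cosine of the functional equation cancels.\<close>

lemma norm_zeta_minus_half:
  fixes t :: real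
  shows "norm (zeta (Complex (- (1 / 2)) t)) = norm (Complex (- (1 / 2)) t) / (2 * pi) * norm (zeta (Complex (3 / 2) t))"
proof -
  define s where "s = Complex (- (1 / 2)) t"
  have s01: "s \<noteq> 0" "s \<noteq> 1" by (auto simp: s_def complex_eq_iff)
  have sZ: "s \<notin> \<int>\<^sub>\<le>\<^sub>0" "s + 1 \<notin> \<int>\<^sub>\<le>\<^sub>0"
  proof -
    have "Re s \<noteq> of_int m" "Re (s + 1) \<noteq> of_int m" for m :: int
    proof -
      have "2 * m \<noteq> - 1" "2 * m \<noteq> 1" by presburger+
      then have "2 * real_of_int m \<noteq> - 1" "2 * real_of_int m \<noteq> 1"
        by (metis of_int_1 of_int_eq_iff of_int_minus of_int_mult of_int_numeral)+
      then show "Re s \<noteq> of_int m" "Re (s + 1) \<noteq> of_int m" by (auto simp: s_def)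
    qed
    then show "s \<notin> \<int>\<^sub>\<le>\<^sub>0" "s + 1 \<notin> \<int>\<^sub>\<le>\<^sub>0" by (metis nonpos_Ints_cases complex_Re_of_int)+
  qed
  have refl: "rGamma (s + 1) * rGamma (- s) = - sin (of_real pi * s) / of_real pi"
    using rGamma_reflection_complex[of "s + 1"] by (simp add: algebra_simps sin_add)
  have cj: "- s = cnj (s + 1)" by (simp add: s_def complex_eq_iff)
  have "norm (rGamma (s + 1)) ^ 2 = norm (rGamma (s + 1) * rGamma (- s))"
    unfolding cj cnj_rGamma[symmetric] by (simp add: norm_mult power2_eq_square)
  also have "\<dots> = norm (sin (of_real pi * s)) / pi" unfolding refl by (simp add: norm_divide)
  finally have g: "norm (rGamma (s + 1)) ^ 2 = norm (sin (of_real pi * s)) / pi" .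
  have dbl: "sin (of_real pi * s) = 2 * sin (of_real pi * s / 2) * cos (of_real pi * s / 2)"
    using sin_double[of "of_real pi * s / 2"] by simp
  \<comment> \<open>The real part of \<open>pi * s / 2\<close> is \<open>- pi / 4\<close>, halfway
    between a zero of the sine and a zero of the cosine; shifting by \<open>pi / 2\<close> is the
    reflection in the imaginary axis.\<close>
  have sc: "norm (sin (of_real pi * s / 2)) = norm (cos (of_real pi * s / 2))"
  proof -
    have "sin (of_real pi * s / 2) = - cos (of_real pi * s / 2 + of_real pi / 2)"
      by (simp add: cos_add)
    also have "of_real pi * s / 2 + of_real pi / 2 = - cnj (of_real pi * s / 2)"
      by (simp add: s_def complex_eq_iff field_simps)
    finally have "sin (of_real pi * s / 2) = - cnj (cos (of_real pi * s / 2))"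
      by (simp add: cnj_cos)
    then show ?thesis by simp
  qed
  define c where "c = norm (cos (of_real pi * s / 2))"
  have c_ge: "c * sqrt (2 / pi) \<ge> 0" by (simp add: c_def)
  have r2: "norm (rGamma (s + 1)) ^ 2 = 2 * c ^ 2 / pi"
    unfolding g dbl norm_mult sc c_def by (simp add: power2_eq_square)
  have "(c * sqrt (2 / pi)) ^ 2 = 2 * c ^ 2 / pi" by (simp add: power_mult_distrib)
  with r2 have rg: "norm (rGamma (s + 1)) = c * sqrt (2 / pi)"
    using power2_eq_imp_eq[OF _ norm_ge_zero c_ge] by metis
  have "rGamma (s + 1) \<noteq> 0" using sZ(2) by (simp only: rGamma_eq_zero_iff not_False_eq_True)
  then have c0: "c \<noteq> 0" using rg by (intro notI) simp
  have "rGamma s = s * rGamma (s + 1)" by (rule rGamma_plus1[symmetric])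
  then have rG: "norm (rGamma s) = norm s * (c * sqrt (2 / pi))" by (simp add: norm_mult rg)
  have "norm (zeta s) * (2 * c) = norm (zeta s * (2 * cos (of_real pi * s / 2)))"
    by (simp add: norm_mult c_def)
  also have "\<dots> = norm (complex_of_real (2 * pi) powr s) * norm (zeta (1 - s)) * norm (rGamma s)"
    unfolding zeta_functional_equation[OF s01] by (simp add: norm_mult)
  also have "norm (complex_of_real (2 * pi) powr s) = 1 / sqrt (2 * pi)"
  proof -
    have "norm (complex_of_real (2 * pi) powr s) = Re (complex_of_real (2 * pi)) powr Re s"
      by (rule norm_powr_real_powr) auto
    also have "\<dots> = (2 * pi) powr - (1 / 2)" by (simp add: s_def)
    also have "\<dots> = inverse ((2 * pi) powr (1 / 2))" by (rule powr_minus)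
    also have "(2 * pi) powr (1 / 2) = sqrt (2 * pi)" by (rule powr_half_sqrt) simp
    finally show ?thesis by (simp only: inverse_eq_divide)
  qed
  also have "1 - s = cnj (Complex (3 / 2) t)" by (simp add: s_def complex_eq_iff)
  also have "norm (zeta (cnj (Complex (3 / 2) t))) = norm (zeta (Complex (3 / 2) t))"
    by (subst zeta_cnj) auto
  finally have "norm (zeta s) * (2 * c) =
      1 / sqrt (2 * pi) * norm (zeta (Complex (3 / 2) t)) * (norm s * (c * sqrt (2 / pi)))"
    unfolding rG .
  also have "\<dots> = (1 / sqrt (2 * pi) * sqrt (2 / pi)) * (norm s * norm (zeta (Complex (3 / 2) t))) * c"
    by (simp only: mult_ac)
  also have "1 / sqrt (2 * pi) * sqrt (2 / pi) = 1 / pi"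
    by (simp add: real_sqrt_mult real_sqrt_divide)
  finally have "(norm (zeta s) * 2) * c = (norm s / pi * norm (zeta (Complex (3 / 2) t))) * c"
    by (simp add: mult_ac)
  then have "norm (zeta s) * 2 = norm s / pi * norm (zeta (Complex (3 / 2) t))"
    using c0 by (subst (asm) mult_cancel_right) simp
  then show ?thesis by (simp add: s_def)
qed

section \<open>Finiteness of the zeros in bounded regions\<close>

text \<open>The Euler--Maclaurin expression continues \<open>(s - 1) * zeta s\<close>
  holomorphically across 1, so \<open>K\<close> may contain 1. It is nonzero at 2, and a holomorphic
  function that is not identically 0 has finitely many zeros on a compact set.\<close>

lemma finite_zeta_zeros:
  assumes K: "compact K" "K \<subseteq> {s. Re s > - 1}"
  shows "finite {\<rho> \<in> K. \<rho> \<noteq> 1 \<and> zeta \<rho> = 0}"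
proof -
  define h where "h = (\<lambda>s. 1 + (s - 1) / 2 + (\<Sum>n. em_term n s))"
  have hol: "h holomorphic_on {s. Re s > - 1}"
    unfolding h_def by (intro holomorphic_intros holomorphic_em_series) auto
  have h: "h s = (s - 1) * zeta s" if "Re s > - 1" "s \<noteq> 1" for s
    using zeta_euler_maclaurin[OF that] by (simp add: h_def)
  have "zeta 2 \<noteq> 0" using norm_zeta_bounds(1)[of 2] by auto
  then have h2: "h 2 \<noteq> 0" using h[of 2] by simp
  have "finite {z \<in> K. h z = 0}"
  proof (cases "h constant_on {s. Re s > - 1}")
    case True
    then obtain c where c: "\<And>s. Re s > - 1 \<Longrightarrow> h s = c" unfolding constant_on_def by auto
    with h2 have "c \<noteq> 0" by force
    then have "{z \<in> K. h z = 0} = {}" using c K(2) by auto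
    then show ?thesis by (simp only: finite.emptyI)
  next
    case False
    show ?thesis
      by (rule holomorphic_compact_finite_zeros[OF hol open_halfspace_Re_gt _ K False])
         (intro convex_connected convex_halfspace_Re_gt)
  qed
  then show ?thesis
    by (rule rev_finite_subset) (use h K in auto)
qed

lemma finite_zeta_zeros_right:
  assumes "\<sigma> > - 1"
  shows "finite {\<rho>. \<rho> \<noteq> 1 \<and> zeta \<rho> = 0 \<and> Re \<rho> \<ge> \<sigma> \<and> \<bar>Im \<rho>\<bar> \<le> T}"
proof (rule finite_subset[OF _ finite_zeta_zeros])
  show "compact (cbox (Complex \<sigma> (- T)) (Complex 2 T))" by (rule compact_cbox)
  show "cbox (Complex \<sigma> (- T)) (Complex 2 T) \<subseteq> {s. Re s > - 1}"
    using assms by (auto simp: cbox_Complex_eq)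
  show "{\<rho>. \<rho> \<noteq> 1 \<and> zeta \<rho> = 0 \<and> Re \<rho> \<ge> \<sigma> \<and> \<bar>Im \<rho>\<bar> \<le> T} \<subseteq>
      {\<rho> \<in> cbox (Complex \<sigma> (- T)) (Complex 2 T). \<rho> \<noteq> 1 \<and> zeta \<rho> = 0}"
  proof safe
    fix \<rho> assume "zeta \<rho> = 0" "Re \<rho> \<ge> \<sigma>" "\<bar>Im \<rho>\<bar> \<le> T"
    moreover from this(1) have "\<not> Re \<rho> \<ge> 2" using norm_zeta_bounds(1)[of \<rho>] by auto
    ultimately show "\<rho> \<in> cbox (Complex \<sigma> (- T)) (Complex 2 T)"
      by (auto simp: in_cbox_complex_iff)
  qed
qed

section \<open>Ordinates and the number of zeros in a window\<close>

lemma finite_nontrivial_zeros: "finite {\<rho> \<in> nontrivial_zeros. 0 < Im \<rho> \<and> Im \<rho> \<le> T}"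
  by (rule finite_subset[OF _ finite_zeta_zeros_right[of 0 T]]) (auto simp: nontrivial_zeros_def)

lemma zero_count_diff:
  assumes "0 \<le> a" "a \<le> b"
  shows "zero_count b = zero_count a +
    (\<Sum>\<rho> \<in> {\<rho> \<in> nontrivial_zeros. a < Im \<rho> \<and> Im \<rho> \<le> b}. nat (zorder zeta \<rho>))"
proof -
  have "{\<rho> \<in> nontrivial_zeros. 0 < Im \<rho> \<and> Im \<rho> \<le> b} =
      {\<rho> \<in> nontrivial_zeros. 0 < Im \<rho> \<and> Im \<rho> \<le> a} \<union> {\<rho> \<in> nontrivial_zeros. a < Im \<rho> \<and> Im \<rho> \<le> b}"
    using assms by auto
  moreover have "finite {\<rho> \<in> nontrivial_zeros. a < Im \<rho> \<and> Im \<rho> \<le> b}"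
    by (rule finite_subset[OF _ finite_nontrivial_zeros[of b]]) (use assms in auto)
  ultimately show ?thesis
    unfolding zero_count_def
    by (simp only:) (rule sum.union_disjoint, auto intro: finite_nontrivial_zeros)
qed

lemma zero_count_mono: "a \<le> b \<Longrightarrow> zero_count a \<le> zero_count b"
  unfolding zero_count_def by (intro sum_mono2 finite_nontrivial_zeros) auto

text \<open>By monotonicity of \<open>zero_count\<close>, the first assumption bounds the set behind
  \<open>ordinate n\<close> from below and the second makes it nonempty; \<open>Inf\<close> on the
  reals is meaningful only with both.\<close>

lemma ordinate_bounds:
  assumes "zero_count a \<le> n" "n < zero_count b"
  shows "a \<le> ordinate n" "ordinate n \<le> b"
proof -
  have lb: "a \<le> T" if "T \<in> {T. zero_count T > n}" for T
    using that assms zero_count_mono[of T a] by (cases "a \<le> T") auto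
  show "a \<le> ordinate n"
    unfolding ordinate_def by (rule cInf_greatest) (use assms lb in auto)
  show "ordinate n \<le> b"
    unfolding ordinate_def by (rule cInf_lower) (use assms lb in \<open>auto intro!: bdd_belowI[of _ a]\<close>)
qed

text \<open>A window of length 8 has room for about \<open>8 / d\<close> gaps of size at least
  \<open>d\<close>, and \<open>d\<close> is a large multiple of \<open>1 / ln a\<close>.\<close>

lemma zeros_in_window_if_gaps_large:
  fixes \<epsilon> :: real
  assumes gaps: "\<And>lam. \<forall>\<^sub>F n in sequentially. lam * average_gap (ordinate n) \<le> ordinate (Suc n) - ordinate n"
    and "\<epsilon> > 0"
  shows "\<forall>\<^sub>F a in at_top. real (zero_count (a + 8)) - real (zero_count a) \<le> \<epsilon> * ln a"
proof -
  \<comment> \<open>With this value the number of gaps is at most 4/9 of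
    \<open>\<epsilon> * ln a\<close>. For large \<open>a\<close> the other 5/9 exceed 1, which pays
    for the one zero more than there are gaps.\<close>
  define lam where "lam = 6 / \<epsilon>"
  have lam: "lam > 0" using assms(2) by (simp add: lam_def)
  obtain N where N: "\<And>n. n \<ge> N \<Longrightarrow> lam * average_gap (ordinate n) \<le> ordinate (Suc n) - ordinate n"
    using gaps[of lam] unfolding eventually_sequentially by blast
  \<comment> \<open>The gap bound holds only from index \<open>N\<close> on. Either
    \<open>zero_count\<close> reaches \<open>N\<close>, or it is bounded; in the second case it
    stays at its maximum from some height on, and later windows are empty.\<close>
  have "\<exists>a0. \<forall>a\<ge>a0. zero_count (a + 8) > zero_count a \<longrightarrow> zero_count a \<ge> N"
  proof (cases "\<exists>a. zero_count a \<ge> N")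
    case True
    then obtain a0 where "zero_count a0 \<ge> N" by blast
    then have "zero_count a \<ge> N" if "a \<ge> a0" for a using order_trans[OF _ zero_count_mono[OF that]] by simp
    then show ?thesis by (intro exI[of _ a0]) simp
  next
    case False
    then have "zero_count a < N" for a by (meson not_le)
    then have "range zero_count \<subseteq> {..<N}" by blast
    then have "finite (range zero_count)" by (rule finite_subset) simp
    then obtain a0 where "zero_count a0 = Max (range zero_count)"
      using Max_in[of "range zero_count"] by (metis (no_types) UNIV_not_empty image_iff image_is_empty)
    then have "zero_count a \<le> zero_count a0" for a using \<open>finite (range zero_count)\<close> by simp
    then have "zero_count (a + 8) \<le> zero_count a" if "a \<ge> a0" for a
      using order_trans[OF _ zero_count_mono[OF that]] by simp
    then show ?thesis by (intro exI[of _ a0]) (auto simp: not_less[symmetric])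
  qed
  then obtain a0 where a0: "\<And>a. a \<ge> a0 \<Longrightarrow> zero_count (a + 8) > zero_count a \<Longrightarrow> zero_count a \<ge> N"
    by blast
  have "real (zero_count (a + 8)) - real (zero_count a) \<le> \<epsilon> * ln a"
    if a: "a \<ge> a0" "a \<ge> 4" "ln a \<ge> 2 / \<epsilon>" for a
  proof (cases "zero_count (a + 8) > zero_count a")
    case False
    then show ?thesis using zero_count_mono[of a "a + 8"] a assms(2) by simp
  next
    case True
    define n0 where "n0 = zero_count a"
    \<comment> \<open>Ordinates are indexed from 0, so those in the window are \<open>n0\<close> up
      to \<open>n0 + m\<close>: m + 1 zeros, m gaps.\<close>
    define m where "m = zero_count (a + 8) - n0 - 1"
    have zc: "zero_count (a + 8) = n0 + m + 1" using True by (simp add: m_def n0_def)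
    have n0: "n0 \<ge> N" using a0[OF a(1) True] by (simp add: n0_def)
    have bnd: "a \<le> ordinate (n0 + j)" "ordinate (n0 + j) \<le> a + 8" if "j \<le> m" for j
      using ordinate_bounds[of a "n0 + j" "a + 8"] that zc by (auto simp: n0_def)
    define d where "d = lam * (2 * pi / ln (a + 8))"
    have gap: "d \<le> ordinate (n0 + Suc j) - ordinate (n0 + j)" if "j < m" for j
    proof -
      have o: "a \<le> ordinate (n0 + j)" "ordinate (n0 + j) \<le> a + 8" using bnd[of j] that by auto
      have "2 * pi / ln (a + 8) \<le> average_gap (ordinate (n0 + j))"
        unfolding average_gap_def using o a by (intro divide_left_mono mult_pos_pos ln_gt_zero ln_mono) auto
      then have "d \<le> lam * average_gap (ordinate (n0 + j))"
        unfolding d_def using lam by (intro mult_left_mono) auto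
      also have "\<dots> \<le> ordinate (n0 + Suc j) - ordinate (n0 + j)"
        using N[of "n0 + j"] n0 by simp
      finally show ?thesis .
    qed
    have "real j * d \<le> ordinate (n0 + j) - ordinate n0" if "j \<le> m" for j
      using that
    proof (induction j)
      case (Suc j)
      then show ?case using gap[of j] by (simp add: algebra_simps)
    qed simp
    from this[of m] have "real m * d \<le> 8" using bnd[of m] bnd[of 0] by simp
    moreover have l8: "0 < ln (a + 8)" "ln (a + 8) \<le> 2 * ln a"
    proof -
      show "0 < ln (a + 8)" using a by (intro ln_gt_zero) auto
      have "4 * a \<le> a * a" using a(2) by (intro mult_right_mono) auto
      then have "a + 8 \<le> a * a" using a(2) by linarith
      then have "ln (a + 8) \<le> ln (a * a)" using a(2) by (intro ln_mono) auto
      then show "ln (a + 8) \<le> 2 * ln a" using a(2) by (simp add: ln_mult)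
    qed
    ultimately have "real m * (lam * (2 * pi)) \<le> 8 * ln (a + 8)"
      by (simp add: d_def field_simps)
    also have "\<dots> \<le> 16 * ln a" using l8 by simp
    finally have "real m * 12 * pi \<le> 16 * ln a * \<epsilon>"
      using assms(2) by (simp add: lam_def field_simps)
    moreover have "real m * 12 * 3 \<le> real m * 12 * pi"
      using pi_gt3 by (intro mult_left_mono) auto
    ultimately have "real m * 36 \<le> 16 * ln a * \<epsilon>" by linarith
    moreover have "2 \<le> \<epsilon> * ln a" using a(3) assms(2) by (simp add: field_simps)
    ultimately have "real m + 1 \<le> \<epsilon> * ln a" by (simp add: mult.commute)
    then show ?thesis using zc by (simp add: n0_def)
  qed
  moreover have "\<forall>\<^sub>F a in at_top. a \<ge> a0 \<and> a \<ge> 4 \<and> ln a \<ge> 2 / \<epsilon>"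
    by (intro eventually_conj eventually_ge_at_top) (use ln_at_top in \<open>simp add: filterlim_at_top\<close>)
  ultimately show ?thesis by (auto elim!: eventually_mono)
qed

text \<open>A zero in each of the disjoint windows of height 8 would make
  \<open>zero_density \<sigma>\<close> grow linearly, against the exponent
  \<open>2 * (1 - \<sigma>) < 1\<close>. The modulus of the imaginary part is used because
  \<open>zero_density\<close> counts both half-planes.\<close>

lemma unbounded_zero_free_windows:
  fixes \<sigma> :: real
  assumes \<sigma>: "1 / 2 < \<sigma>"
    and dens: "(\<lambda>T. real (zero_density \<sigma> T)) \<in> O[at_top](\<lambda>T. T powr (2 * (1 - \<sigma>)) * ln T powr (- B))"
    and B: "B \<ge> 0"
  shows "\<exists>T\<ge>T0. \<forall>\<rho>. \<rho> \<noteq> 1 \<longrightarrow> zeta \<rho> = 0 \<longrightarrow> \<sigma> < Re \<rho> \<longrightarrow> \<bar>\<bar>Im \<rho>\<bar> - T\<bar> \<ge> 4"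
proof (rule ccontr)
  assume contra: "\<not> ?thesis"
  \<comment> \<open>From 5 on the logarithm is at least 1, so its power with exponent
    \<open>- B\<close> is at most 1.\<close>
  define T1 where "T1 = max T0 5"
  define Z where "Z = (\<lambda>T. {\<rho>. \<rho> \<noteq> 1 \<and> zeta \<rho> = 0 \<and> Re \<rho> > \<sigma> \<and> \<bar>Im \<rho>\<bar> < T})"
  have "\<exists>\<rho>. \<rho> \<noteq> 1 \<and> zeta \<rho> = 0 \<and> \<sigma> < Re \<rho> \<and> \<bar>\<bar>Im \<rho>\<bar> - (T1 + 8 * real j)\<bar> < 4" for j :: nat
  proof -
    have "T1 + 8 * real j \<ge> T0" by (simp add: T1_def)
    with contra show ?thesis by (meson not_le)
  qed
  then obtain r where r: "\<And>j::nat. r j \<noteq> 1 \<and> zeta (r j) = 0 \<and> \<sigma> < Re (r j) \<and> \<bar>\<bar>Im (r j)\<bar> - (T1 + 8 * real j)\<bar> < 4"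
    by metis
  have inj: "inj r"
  proof (rule injI)
    fix i j assume "r i = r j"
    then have "\<bar>\<bar>Im (r i)\<bar> - (T1 + 8 * real i)\<bar> < 4" "\<bar>\<bar>Im (r i)\<bar> - (T1 + 8 * real j)\<bar> < 4"
      using r[of i] r[of j] by simp_all
    then have "\<bar>8 * real i - 8 * real j\<bar> < 8" by linarith
    then show "i = j" by linarith
  qed
  have lower: "J \<le> zero_density \<sigma> (T1 + 8 * real J)" for J
  proof -
    have "finite (Z (T1 + 8 * real J))"
      by (rule finite_subset[OF _ finite_zeta_zeros_right[of \<sigma> "T1 + 8 * real J"]]) (use \<sigma> in \<open>auto simp: Z_def\<close>)
    moreover have "r ` {..<J} \<subseteq> Z (T1 + 8 * real J)"
    proof safe
      fix j assume "j < J"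
      then have "real j + 1 \<le> real J" by simp
      then show "r j \<in> Z (T1 + 8 * real J)" using r[of j] unfolding Z_def by (simp; linarith)
    qed
    ultimately have "card (r ` {..<J}) \<le> card (Z (T1 + 8 * real J))" by (rule card_mono)
    then show ?thesis
      using card_image[OF inj_on_subset[OF inj subset_UNIV], of "{..<J}"] by (simp add: zero_density_def Z_def)
  qed
  have "(\<lambda>J. real J) \<in> O(\<lambda>J. (T1 + 8 * real J) powr (2 * (1 - \<sigma>)) * ln (T1 + 8 * real J) powr (- B))"
  proof (rule landau_o.big_trans)
    show "(\<lambda>J. real J) \<in> O(\<lambda>J. real (zero_density \<sigma> (T1 + 8 * real J)))"
      using lower by (intro landau_o.big_mono) auto
    have "filterlim (\<lambda>J. T1 + 8 * real J) at_top sequentially" by real_asymp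
    from landau_o.big.compose[OF dens this]
    show "(\<lambda>J. real (zero_density \<sigma> (T1 + 8 * real J))) \<in>
        O(\<lambda>J. (T1 + 8 * real J) powr (2 * (1 - \<sigma>)) * ln (T1 + 8 * real J) powr (- B))" .
  qed
  also have "(\<lambda>J. (T1 + 8 * real J) powr (2 * (1 - \<sigma>)) * ln (T1 + 8 * real J) powr (- B)) \<in>
      O(\<lambda>J. (T1 + 8 * real J) powr (2 * (1 - \<sigma>)))"
  proof (intro landau_o.big_mono always_eventually allI)
    fix J :: nat
    have "1 \<le> ln (T1 + 8 * real J)"
      using exp_le by (subst ln_ge_iff) (auto simp: T1_def)
    then have "ln (T1 + 8 * real J) powr (- B) \<le> 1"
      using B powr_mono[of "- B" 0 "ln (T1 + 8 * real J)"] by simp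
    then show "norm ((T1 + 8 * real J) powr (2 * (1 - \<sigma>)) * ln (T1 + 8 * real J) powr (- B))
        \<le> norm ((T1 + 8 * real J) powr (2 * (1 - \<sigma>)))"
      by (simp add: mult_left_le)
  qed
  also have "(\<lambda>J. (T1 + 8 * real J) powr (2 * (1 - \<sigma>))) \<in> o(\<lambda>J. real J)"
    using \<sigma> by real_asymp
  finally have "(\<lambda>J. real J) \<in> o(\<lambda>J. real J)" .
  then have "eventually (\<lambda>J. real J = 0) sequentially"
    by (simp add: landau_o.small_refl_iff)
  then have "eventually (\<lambda>J::nat. False) sequentially"
    using eventually_gt_at_top[of 0] by eventually_elim simp
  then show False by simp
qed

section \<open>Normal families\<close>

text \<open>The modulus of a limit function has a maximum at the interior point 0, being 1 on the
  small ball; so the limit is constant, and information near the centre spreads over the whole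
  disc.\<close>

lemma montel_unimodular:
  fixes H :: "nat \<Rightarrow> complex \<Rightarrow> complex"
  assumes "0 < r" "r \<le> R"
    and hol: "\<And>k. H k holomorphic_on ball 0 R"
    and bnd: "\<And>k w. w \<in> ball 0 R \<Longrightarrow> norm (H k w) \<le> M"
    and lim: "\<And>w. w \<in> ball 0 r \<Longrightarrow> (\<lambda>k. norm (H k w)) \<longlonglongrightarrow> 1"
  obtains \<phi> :: "nat \<Rightarrow> nat" where "strict_mono \<phi>"
    "\<And>w. w \<in> ball 0 R \<Longrightarrow> (\<lambda>k. norm (H (\<phi> k) w)) \<longlonglongrightarrow> 1"
proof -
  obtain g \<phi> where g: "g holomorphic_on ball 0 R" and \<phi>: "strict_mono (\<phi> :: nat \<Rightarrow> nat)"
    and g_lim: "\<And>x. x \<in> ball 0 R \<Longrightarrow> (\<lambda>n. H (\<phi> n) x) \<longlonglongrightarrow> g x"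
  proof (rule Montel[of "ball 0 R" "range H" H])
    show "\<exists>B. \<forall>h\<in>range H. \<forall>z\<in>K. norm (h z) \<le> B" if "compact K" "K \<subseteq> ball 0 R" for K
      using bnd that by (intro exI[of _ M]) blast
  qed (use hol in auto)
  have g1: "norm (g w) = 1" if "w \<in> ball 0 r" for w
  proof (rule LIMSEQ_unique)
    have "w \<in> ball 0 R" using that assms(2) by auto
    then show "(\<lambda>n. norm (H (\<phi> n) w)) \<longlonglongrightarrow> norm (g w)" by (intro tendsto_norm g_lim)
    show "(\<lambda>n. norm (H (\<phi> n) w)) \<longlonglongrightarrow> 1"
      using LIMSEQ_subseq_LIMSEQ[OF lim[OF that] \<phi>] by (simp add: o_def)
  qed
  have "g constant_on ball 0 R"
  proof (rule maximum_modulus_principle[OF g, of "ball 0 r" 0])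
    show "norm (g z) \<le> norm (g 0)" if "z \<in> ball 0 r" for z
      using g1[OF that] g1[of 0] assms(1) by simp
  qed (use assms in auto)
  then obtain c where c: "\<And>w. w \<in> ball 0 R \<Longrightarrow> g w = c" by (auto simp: constant_on_def)
  have "norm (g w) = 1" if "w \<in> ball 0 R" for w
    using c[OF that] c[of 0] g1[of 0] assms by auto
  then have "(\<lambda>k. norm (H (\<phi> k) w)) \<longlonglongrightarrow> 1" if "w \<in> ball 0 R" for w
    using tendsto_norm[OF g_lim[OF that]] that by simp
  with \<phi> show ?thesis by (rule that)
qed

section \<open>Dividing out finitely many zeros\<close>

text \<open>Induction on \<open>A\<close>: dividing by the full power at a new point
  \<open>a\<close> leaves a removable singularity, filled by means of the local factorization at
  \<open>a\<close>. That the quotient is nonzero on \<open>A\<close> records that the multiplicities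
  are exhausted.\<close>

lemma holomorphic_factor_zeros:
  fixes f :: "complex \<Rightarrow> complex"
  assumes f: "f holomorphic_on S" "open S" "connected S" "\<exists>w\<in>S. f w \<noteq> 0"
    and A: "finite A" "A \<subseteq> S"
  shows "\<exists>g. g holomorphic_on S \<and> (\<forall>z\<in>S. f z = g z * (\<Prod>\<rho>\<in>A. (z - \<rho>) ^ nat (zorder f \<rho>))) \<and> (\<forall>\<rho>\<in>A. g \<rho> \<noteq> 0)"
  using A
proof (induction A rule: finite_induct)
  case empty
  show ?case using f by (intro exI[of _ f]) auto
next
  case (insert a A)
  define n where "n = nat (zorder f a)"
  define P where "P = (\<lambda>z. \<Prod>\<rho>\<in>A. (z - \<rho>) ^ nat (zorder f \<rho>))"
  obtain g where g: "g holomorphic_on S" "\<And>z. z \<in> S \<Longrightarrow> f z = g z * P z" "\<And>\<rho>. \<rho> \<in> A \<Longrightarrow> g \<rho> \<noteq> 0"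
    using insert.IH insert.prems unfolding P_def by auto
  have aS: "a \<in> S" using insert.prems by simp
  obtain r h where r: "r > 0" "cball a r \<subseteq> S" and h: "h holomorphic_on cball a r"
    "\<And>w. w \<in> cball a r \<Longrightarrow> f w = h w * (w - a) ^ n" "\<And>w. w \<in> cball a r \<Longrightarrow> h w \<noteq> 0"
    using zorder_exist_zero[OF f(1,2,3) aS f(4)] unfolding n_def by blast
  have P_hol: "P holomorphic_on X" for X unfolding P_def by (intro holomorphic_intros)
  have Pa: "P a \<noteq> 0" unfolding P_def using insert.hyps by auto
  \<comment> \<open>Away from \<open>a\<close> the local factorization shows that \<open>f\<close>
    has no zero in the ball, so its factor \<open>P\<close> has none either.\<close>
  have P0: "P w \<noteq> 0" if "w \<in> ball a r" for w
  proof (cases "w = a")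
    case False
    have w: "w \<in> cball a r" using that by auto
    have "g w * P w = h w * (w - a) ^ n" using g(2)[of w] h(2)[OF w] w r(2) by auto
    moreover have "h w * (w - a) ^ n \<noteq> 0" using False h(3)[OF w] by simp
    ultimately show ?thesis by auto
  qed (use Pa in simp)
  define g' where "g' = (\<lambda>z. if z = a then h a / P a else g z / (z - a) ^ n)"
  have g'_ball: "g' w = h w / P w" if "w \<in> ball a r" for w
  proof (cases "w = a")
    case False
    have w: "w \<in> cball a r" using that by auto
    have "g w * P w = h w * (w - a) ^ n" using g(2)[of w] h(2)[OF w] w r(2) by auto
    then show ?thesis using False P0[OF that] by (simp add: g'_def frac_eq_eq)
  qed (simp add: g'_def)
  have "g' holomorphic_on (S - {a}) \<union> ball a r"
  proof (rule holomorphic_on_Un)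
    have "(\<lambda>z. g z / (z - a) ^ n) holomorphic_on S - {a}"
      by (intro holomorphic_intros holomorphic_on_subset[OF g(1)]) auto
    then show "g' holomorphic_on S - {a}"
      by (rule holomorphic_transform) (auto simp: g'_def)
    have "(\<lambda>z. h z / P z) holomorphic_on ball a r"
      using P0 by (intro holomorphic_intros P_hol holomorphic_on_subset[OF h(1)]) auto
    then show "g' holomorphic_on ball a r"
      by (rule holomorphic_transform) (simp add: g'_ball)
  qed (use f(2) in auto)
  then have "g' holomorphic_on S"
    by (rule holomorphic_on_subset) (use r in auto)
  moreover have "f z = g' z * (\<Prod>\<rho>\<in>insert a A. (z - \<rho>) ^ nat (zorder f \<rho>))" if "z \<in> S" for z
  proof -
    have prod: "(\<Prod>\<rho>\<in>insert a A. (z - \<rho>) ^ nat (zorder f \<rho>)) = (z - a) ^ n * P z"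
      using insert.hyps by (simp add: P_def n_def)
    show ?thesis
    proof (cases "z = a")
      case True
      then show ?thesis unfolding prod using h(2)[of a] r Pa by (simp add: g'_def)
    next
      case False
      then show ?thesis unfolding prod using g(2)[OF that] by (simp add: g'_def)
    qed
  qed
  moreover have "g' \<rho> \<noteq> 0" if "\<rho> \<in> insert a A" for \<rho>
    using that g(3) h(3)[of a] Pa insert.hyps r by (auto simp: g'_def)
  ultimately show ?case by blast
qed

lemma norm_prod_power_ge:
  fixes d :: real
  assumes "0 \<le> d" "\<And>\<rho>. \<rho> \<in> A \<Longrightarrow> d \<le> norm (f \<rho> :: complex)"
  shows "d ^ (\<Sum>\<rho>\<in>A. m \<rho>) \<le> norm (\<Prod>\<rho>\<in>A. f \<rho> ^ m \<rho>)"
proof -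
  have "d ^ (\<Sum>\<rho>\<in>A. m \<rho>) = (\<Prod>\<rho>\<in>A. d ^ m \<rho>)" by (rule power_sum)
  also have "\<dots> \<le> (\<Prod>\<rho>\<in>A. norm (f \<rho> ^ m \<rho>))"
    using assms by (intro prod_mono) (auto simp: norm_power intro!: power_mono)
  also have "\<dots> = norm (\<Prod>\<rho>\<in>A. f \<rho> ^ m \<rho>)" by (rule prod_norm)
  finally show ?thesis .
qed

lemma norm_prod_power_le_1:
  assumes "\<And>\<rho>. \<rho> \<in> A \<Longrightarrow> norm (f \<rho> :: complex) \<le> 1"
  shows "norm (\<Prod>\<rho>\<in>A. f \<rho> ^ m \<rho>) \<le> 1"
proof -
  have "norm (\<Prod>\<rho>\<in>A. f \<rho> ^ m \<rho>) = (\<Prod>\<rho>\<in>A. norm (f \<rho> ^ m \<rho>))" by (rule prod_norm[symmetric])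
  also have "\<dots> \<le> 1" using assms by (intro prod_le_1) (auto simp: norm_power power_le_one)
  finally show ?thesis .
qed

text \<open>The other factors on the right of the functional equation are a power and
  \<open>rGamma \<rho>\<close>, which vanishes only at real points.\<close>

lemma zeta_zero_reflect:
  assumes "zeta \<rho> = 0" "Im \<rho> \<noteq> 0"
  shows "zeta (1 - \<rho>) = 0"
proof -
  have "\<rho> \<noteq> 0" "\<rho> \<noteq> 1" using assms by auto
  from zeta_functional_equation[OF this] assms(1)
  have "of_real (2 * pi) powr \<rho> * zeta (1 - \<rho>) * rGamma \<rho> = 0" by simp
  moreover have "rGamma \<rho> \<noteq> 0"
    using assms(2) by (auto simp: rGamma_eq_zero_iff elim!: nonpos_Ints_cases)
  ultimately show ?thesis by simp
qed

lemma cball_Complex_bounds: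
  assumes "z \<in> cball (Complex a b) r"
  shows "a - r \<le> Re z" "Re z \<le> a + r" "b - r \<le> Im z" "Im z \<le> b + r"
proof -
  have "norm (z - Complex a b) \<le> r" using assms by (simp add: dist_norm norm_minus_commute)
  moreover have "\<bar>Re (z - Complex a b)\<bar> \<le> norm (z - Complex a b)" "\<bar>Im (z - Complex a b)\<bar> \<le> norm (z - Complex a b)"
    by (rule abs_Re_le_cmod abs_Im_le_cmod)+
  ultimately show "a - r \<le> Re z" "Re z \<le> a + r" "b - r \<le> Im z" "Im z \<le> b + r" by auto
qed

text \<open>After division by the zeros near \<open>3 + \<i> T\<close>, the function \<open>zeta\<close> has a logarithm of size
  \<open>O(ln T)\<close> on a disc reaching beyond the critical strip; \<open>H\<close> is the exponential of that logarithm
  divided by \<open>ln T\<close>.\<close>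

lemma zeta_local_normalization:
  fixes T \<epsilon> C :: real
  assumes C: "C \<ge> 1" "\<And>s. Re s \<ge> - (9 / 10) \<Longrightarrow> norm (s - 1) \<ge> 1 \<Longrightarrow> norm (zeta s) \<le> C * (1 + norm s) ^ 2"
    and T: "T \<ge> 20"
    and free: "\<And>\<rho>. \<rho> \<noteq> 1 \<Longrightarrow> zeta \<rho> = 0 \<Longrightarrow> 9 / 10 < Re \<rho> \<Longrightarrow> \<bar>\<bar>Im \<rho>\<bar> - T\<bar> \<ge> 4"
    and count: "real (zero_count (T + 4)) - real (zero_count (T - 4)) \<le> \<epsilon> * ln T"
    and \<epsilon>: "0 \<le> \<epsilon>" "\<epsilon> \<le> 1"
  shows "\<exists>H. H holomorphic_on ball 0 (37 / 10) \<and>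
    (\<forall>w\<in>ball 0 (37 / 10). norm (H w) \<le> exp (ln C + 3 + ln 80)) \<and>
    (\<forall>w\<in>ball 0 1. exp (- ln 4 / ln T) \<le> norm (H w) \<and> norm (H w) \<le> exp (ln 2 / ln T + \<epsilon> * ln 80)) \<and>
    exp (1 - ln 8 / ln T - \<epsilon> * ln 80) * norm (H (- (3 / 2))) \<le> norm (H (- (7 / 2)))"
proof -
  \<comment> \<open>Around 3 the unit disc lies in Re s \<ge> 2, where the modulus of zeta is
    between 1/4 and 2. Radius 37/10 takes in -1/2 + \<i> T, at distance 7/2; radius 38/10 stays in
    Re s \<ge> -8/10, where the polynomial bound holds. Both fit into a window of half-height
    4.\<close>
  define c where "c = Complex 3 T"
  define A where "A = {\<rho> \<in> cball c (37 / 10). \<rho> \<noteq> 1 \<and> zeta \<rho> = 0}"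
  define m where "m = (\<lambda>\<rho>. nat (zorder zeta \<rho>))"
  define n where "n = (\<Sum>\<rho>\<in>A. m \<rho>)"
  \<comment> \<open>Points of the disc of radius 4 are at distance at most 8 from each zero, so the
    scaling makes all factors at most 1. At distance at least 1/10 a factor is at least
    1/80.\<close>
  define P where "P = (\<lambda>z. \<Prod>\<rho>\<in>A. ((z - \<rho>) / 8) ^ m \<rho>)"
  have lnT: "ln T \<ge> 1" using T exp_le by (subst ln_ge_iff) auto
  have ball_bounds: "3 - r \<le> Re z" "Re z \<le> 3 + r" "T - r \<le> Im z" "Im z \<le> T + r" if "z \<in> cball c r" for z r
    using cball_Complex_bounds[of z 3 T r] that by (auto simp: c_def)
  have not1: "z \<noteq> 1" "norm (z - 1) \<ge> 1" if "z \<in> cball c 4" for z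
  proof -
    have "Im (z - 1) \<ge> 1" using ball_bounds(3)[OF that] T by simp
    then show "norm (z - 1) \<ge> 1" using abs_Im_le_cmod[of "z - 1"] by linarith
    then show "z \<noteq> 1" by auto
  qed
  have finA: "finite A"
    unfolding A_def
  proof (rule finite_zeta_zeros)
    show "cball c (37 / 10) \<subseteq> {s. Re s > - 1}"
    proof
      fix z assume "z \<in> cball c (37 / 10)"
      from ball_bounds(1)[OF this] show "z \<in> {s. Re s > - 1}" by simp
    qed
  qed simp
  have A_bounds: "1 / 10 \<le> Re \<rho>" "Re \<rho> \<le> 9 / 10" "T - 37 / 10 \<le> Im \<rho>" "Im \<rho> \<le> T + 37 / 10" if "\<rho> \<in> A" for \<rho>
  proof -
    have \<rho>: "\<rho> \<in> cball c (37 / 10)" "\<rho> \<noteq> 1" "zeta \<rho> = 0" using that by (auto simp: A_def)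
    show im: "T - 37 / 10 \<le> Im \<rho>" "Im \<rho> \<le> T + 37 / 10" using ball_bounds[OF \<rho>(1)] by auto
    then have i: "\<bar>\<bar>Im \<rho>\<bar> - T\<bar> < 4" using T by linarith
    show "Re \<rho> \<le> 9 / 10" using free[OF \<rho>(2,3)] i by force
    \<comment> \<open>The reflected zero \<open>1 - \<rho>\<close> has the same modulus of the
      imaginary part, so the window is free for it too.\<close>
    have i0: "Im \<rho> \<noteq> 0" using im T by auto
    then have "1 - \<rho> \<noteq> 1" by auto
    from free[OF this zeta_zero_reflect[OF \<rho>(3) i0]] i show "1 / 10 \<le> Re \<rho>" by force
  qed
  have n_le: "real n \<le> \<epsilon> * ln T"
  proof -
    have "n \<le> (\<Sum>\<rho> \<in> {\<rho> \<in> nontrivial_zeros. T - 4 < Im \<rho> \<and> Im \<rho> \<le> T + 4}. nat (zorder zeta \<rho>))"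
      unfolding n_def m_def
    proof (rule sum_mono2)
      show "finite {\<rho> \<in> nontrivial_zeros. T - 4 < Im \<rho> \<and> Im \<rho> \<le> T + 4}"
        by (rule finite_subset[OF _ finite_nontrivial_zeros[of "T + 4"]]) (use T in auto)
      show "A \<subseteq> {\<rho> \<in> nontrivial_zeros. T - 4 < Im \<rho> \<and> Im \<rho> \<le> T + 4}"
      proof
        fix \<rho> assume "\<rho> \<in> A"
        moreover from this have "zeta \<rho> = 0" by (simp add: A_def)
        ultimately show "\<rho> \<in> {\<rho> \<in> nontrivial_zeros. T - 4 < Im \<rho> \<and> Im \<rho> \<le> T + 4}"
          using A_bounds[of \<rho>] by (auto simp: nontrivial_zeros_def)
      qed
    qed simp
    then have "zero_count (T - 4) + n \<le> zero_count (T + 4)"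
      using zero_count_diff[of "T - 4" "T + 4"] T by simp
    then have "real (zero_count (T - 4)) + real n \<le> real (zero_count (T + 4))"
      by (metis of_nat_add of_nat_mono)
    then show ?thesis using count by linarith
  qed
  have P_le: "norm (P z) \<le> 1" if "z \<in> cball c 4" for z
    unfolding P_def
  proof (rule norm_prod_power_le_1)
    fix \<rho> assume "\<rho> \<in> A"
    then have "dist c \<rho> \<le> 4" by (simp add: A_def)
    then have "dist z \<rho> \<le> 8" using that dist_triangle[of z \<rho> c] by (simp add: dist_commute)
    then show "norm ((z - \<rho>) / 8) \<le> 1" by (simp add: dist_norm norm_divide)
  qed
  have P_ge: "(1 / 80) ^ n \<le> norm (P z)" if "\<And>\<rho>. \<rho> \<in> A \<Longrightarrow> norm (z - \<rho>) \<ge> 1 / 10" for z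
    unfolding P_def n_def by (rule norm_prod_power_ge) (use that in \<open>auto simp: norm_divide\<close>)
  have P_ge_right: "(1 / 80) ^ n \<le> norm (P z)" if "Re z \<ge> 1" for z
  proof (rule P_ge)
    fix \<rho> assume "\<rho> \<in> A"
    then have "Re (z - \<rho>) \<ge> 1 / 10" using A_bounds(2)[of \<rho>] that by simp
    then show "norm (z - \<rho>) \<ge> 1 / 10" using complex_Re_le_cmod[of "z - \<rho>"] by linarith
  qed
  have "\<exists>g. g holomorphic_on - {1} \<and> (\<forall>z\<in>- {1}. zeta z = g z * (\<Prod>\<rho>\<in>A. (z - \<rho>) ^ m \<rho>)) \<and> (\<forall>\<rho>\<in>A. g \<rho> \<noteq> 0)"
    unfolding m_def
  proof (rule holomorphic_factor_zeros[OF zeta_holomorphic _ _ _ finA])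
    show "connected (- {1::complex})" by (rule connected_punctured_universe) auto
    have "zeta 2 \<noteq> 0" using norm_zeta_bounds(1)[of 2] by auto
    then show "\<exists>w\<in>- {1}. zeta w \<noteq> 0" by (intro bexI[of _ 2]) auto
  qed (auto simp: A_def)
  then obtain g where g: "g holomorphic_on - {1}" "\<And>z. z \<noteq> 1 \<Longrightarrow> zeta z = g z * (\<Prod>\<rho>\<in>A. (z - \<rho>) ^ m \<rho>)"
    "\<And>\<rho>. \<rho> \<in> A \<Longrightarrow> g \<rho> \<noteq> 0" by auto
  define G where "G = (\<lambda>z. g z * 8 ^ n)"
  have G_hol: "G holomorphic_on - {1}" unfolding G_def by (intro holomorphic_intros g)
  have G: "zeta z = G z * P z" if "z \<noteq> 1" for z
  proof -
    have "(\<Prod>\<rho>\<in>A. (z - \<rho>) ^ m \<rho>) = 8 ^ n * P z"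
      unfolding P_def n_def power_sum prod.distrib[symmetric] by (simp add: power_divide)
    then show ?thesis using g(2)[OF that] by (simp add: G_def)
  qed
  have G_nz: "G z \<noteq> 0" if "z \<in> cball c (37 / 10)" for z
  proof
    assume G0: "G z = 0"
    have "z \<noteq> 1" using not1(1)[of z] that by auto
    with G[of z] G0 have "z \<in> A" using that by (simp add: A_def)
    then show False using g(3)[of z] G0 by (simp add: G_def)
  qed
  have ball_sub: "cball c r \<subseteq> - {1}" if "r \<le> 4" for r
    using not1(1) that by (meson ComplI cball_subset_cball_iff singletonD subset_cball subset_iff)
  \<comment> \<open>Inside the disc \<open>P\<close> may vanish. On the circle of radius 38/10 every
    zero is at least 1/10 away, so the quotient is estimated there and the maximum principle carries
    the bound inwards.\<close>
  have G_le: "norm (G z) \<le> C * T ^ 3 * 80 ^ n" if "z \<in> cball c (37 / 10)" for z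
  proof (rule maximum_modulus_frontier[of G "cball c (38 / 10)"])
    show "G holomorphic_on interior (cball c (38 / 10))"
      by (rule holomorphic_on_subset[OF G_hol subset_trans[OF interior_subset ball_sub]]) simp
    show "continuous_on (closure (cball c (38 / 10))) G"
      using ball_sub[of "38 / 10"]
      by (intro holomorphic_on_imp_continuous_on holomorphic_on_subset[OF G_hol]) auto
    show "z \<in> cball c (38 / 10)" using that by auto
    fix y assume "y \<in> frontier (cball c (38 / 10))"
    then have y: "dist c y = 38 / 10" by (simp add: frontier_cball sphere_def)
    then have y4: "y \<in> cball c 4" "y \<in> cball c (38 / 10)" by auto
    have "norm (zeta y) \<le> C * (1 + norm y) ^ 2"
      using C(2)[of y] not1(2)[OF y4(1)] ball_bounds(1)[OF y4(2)] by simp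
    also have "\<dots> \<le> C * (2 * T) ^ 2"
    proof (intro mult_left_mono power_mono)
      have "norm y \<le> \<bar>Re y\<bar> + \<bar>Im y\<bar>" by (rule cmod_le)
      then show "1 + norm y \<le> 2 * T" using ball_bounds[OF y4(2)] T by linarith
    qed (use C in auto)
    also have "\<dots> \<le> C * T ^ 3"
    proof (intro mult_left_mono)
      have "4 * T ^ 2 \<le> T * T ^ 2" using T by (intro mult_right_mono) auto
      then show "(2 * T) ^ 2 \<le> T ^ 3" by (simp add: power_mult_distrib power3_eq_cube power2_eq_square)
    qed (use C in auto)
    finally have z: "norm (zeta y) \<le> C * T ^ 3" .
    have "norm (y - \<rho>) \<ge> 1 / 10" if "\<rho> \<in> A" for \<rho>
      using that y dist_triangle[of c y \<rho>] by (simp add: A_def dist_norm norm_minus_commute)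
    then have "(1 / 80) ^ n \<le> norm (P y)" by (rule P_ge)
    then have "norm (G y) * (1 / 80) ^ n \<le> norm (G y) * norm (P y)" by (intro mult_left_mono) auto
    also have "\<dots> = norm (zeta y)" using G[of y] not1(1)[OF y4(1)] by (simp add: norm_mult)
    also note z
    finally show "norm (G y) \<le> C * T ^ 3 * 80 ^ n" by (simp add: power_divide field_simps)
  qed auto
  obtain L where L: "L holomorphic_on ball c (37 / 10)" "\<And>z. z \<in> ball c (37 / 10) \<Longrightarrow> G z = exp (L z)"
  proof (rule contractible_imp_holomorphic_log[of G "ball c (37 / 10)"])
    show "G holomorphic_on ball c (37 / 10)"
      by (rule holomorphic_on_subset[OF G_hol subset_trans[OF ball_subset_cball ball_sub]]) simp
    show "contractible (ball c (37 / 10))" by (intro convex_imp_contractible convex_ball)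
    show "G z \<noteq> 0" if "z \<in> ball c (37 / 10)" for z using G_nz that by auto
  qed (rule that)
  \<comment> \<open>Its modulus is that of \<open>G\<close> raised to the power
    \<open>1 / ln T\<close>.\<close>
  define H where "H = (\<lambda>w. exp (L (c + w) / of_real (ln T)))"
  have norm_H: "norm (H w) = exp (ln (norm (G (c + w))) / ln T)" if "w \<in> ball 0 (37 / 10)" for w
  proof -
    have "c + w \<in> ball c (37 / 10)" using that by (simp add: dist_norm)
    then have "ln (norm (G (c + w))) = Re (L (c + w))" by (simp add: L(2))
    moreover have "Re (L (c + w) / of_real (ln T)) = Re (L (c + w)) / ln T" by (rule Re_divide_of_real)
    ultimately show ?thesis by (simp add: H_def)
  qed
  have G_pos: "norm (G (c + w)) > 0" if "w \<in> ball 0 (37 / 10)" for w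
    using G_nz[of "c + w"] that by (simp add: dist_norm)
  \<comment> \<open>Passing between zeta and \<open>G\<close> costs at most a factor
    \<open>80 ^ n\<close> in each estimate; on the scale of \<open>ln T\<close> this is an error
    \<open>\<epsilon> * ln 80\<close>.\<close>
  have n_div: "real n * ln 80 / ln T \<le> \<epsilon> * ln 80"
    using n_le lnT mult_right_mono[OF n_le, of "ln 80"] by (simp add: divide_le_eq mult_ac)
  have ln80: "ln (a * 80 ^ n) = ln a + real n * ln 80" if "a > 0" for a :: real
    using that by (simp add: ln_mult ln_realpow)
  have "H holomorphic_on ball 0 (37 / 10)"
  proof -
    have "(\<lambda>w. L (c + w)) holomorphic_on ball 0 (37 / 10)"
      by (rule holomorphic_on_compose_gen[OF _ L(1), unfolded o_def])
         (auto intro!: holomorphic_intros simp: dist_norm)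
    then show ?thesis unfolding H_def using lnT by (intro holomorphic_intros) auto
  qed
  moreover have "norm (H w) \<le> exp (ln C + 3 + ln 80)" if "w \<in> ball 0 (37 / 10)" for w
  proof -
    have "norm (G (c + w)) \<le> C * T ^ 3 * 80 ^ n" using that by (intro G_le) (simp add: dist_norm)
    then have "ln (norm (G (c + w))) \<le> ln (C * T ^ 3 * 80 ^ n)"
      using G_pos[OF that] by (intro ln_mono) auto
    also have "\<dots> = ln C + 3 * ln T + real n * ln 80"
      using C(1) T by (subst ln80) (auto simp: ln_mult ln_realpow)
    finally have "ln (norm (G (c + w))) / ln T \<le> (ln C + 3 * ln T + real n * ln 80) / ln T"
      using lnT by (intro divide_right_mono) auto
    also have "\<dots> = ln C / ln T + 3 + real n * ln 80 / ln T"
      using lnT by (simp add: add_divide_distrib)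
    also have "\<dots> \<le> ln C + 3 + ln 80"
    proof (intro add_mono order_refl)
      show "ln C / ln T \<le> ln C" using C(1) lnT by (simp add: divide_le_eq mult_left_le_one_le mult_ge1_I mult_le_cancel_left1)
      have "\<epsilon> * ln 80 \<le> 1 * ln 80" using \<epsilon> by (intro mult_right_mono) auto
      then show "real n * ln 80 / ln T \<le> ln 80" using n_div by linarith
    qed
    finally show ?thesis unfolding norm_H[OF that] by simp
  qed
  moreover have "exp (- ln 4 / ln T) \<le> norm (H w) \<and> norm (H w) \<le> exp (ln 2 / ln T + \<epsilon> * ln 80)"
    if "w \<in> ball 0 1" for w
  proof -
    have w: "w \<in> ball 0 (37 / 10)" using that by auto
    have cw: "c + w \<in> cball c 1" using that by (simp add: dist_norm)
    have re: "Re (c + w) \<ge> 2" using ball_bounds(1)[OF cw] by simp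
    have "c + w \<noteq> 1" using not1(1)[of "c + w"] cw by auto
    then have z: "norm (zeta (c + w)) = norm (G (c + w)) * norm (P (c + w))"
      using G by (simp add: norm_mult)
    have "norm (G (c + w)) * norm (P (c + w)) \<le> norm (G (c + w)) * 1"
      using P_le[of "c + w"] cw by (intro mult_left_mono) auto
    then have "1 / 4 \<le> norm (G (c + w))" using norm_zeta_bounds(1)[OF re] z by linarith
    then have "ln (1 / 4) \<le> ln (norm (G (c + w)))" by (intro ln_mono) auto
    then have 1: "- ln 4 / ln T \<le> ln (norm (G (c + w))) / ln T"
      using lnT by (intro divide_right_mono) (auto simp: ln_div)
    have "norm (G (c + w)) * (1 / 80) ^ n \<le> norm (G (c + w)) * norm (P (c + w))"
      using P_ge_right[of "c + w"] re by (intro mult_left_mono) auto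
    also have "\<dots> \<le> 2" using norm_zeta_bounds(2)[OF re] z by simp
    finally have "norm (G (c + w)) \<le> 2 * 80 ^ n" by (simp add: power_divide field_simps)
    then have "ln (norm (G (c + w))) \<le> ln (2 * 80 ^ n)" using G_pos[OF w] by (intro ln_mono) auto
    also have "\<dots> = ln 2 + real n * ln 80" by (rule ln80) simp
    finally have "ln (norm (G (c + w))) / ln T \<le> (ln 2 + real n * ln 80) / ln T"
      using lnT by (intro divide_right_mono) auto
    also have "\<dots> \<le> ln 2 / ln T + \<epsilon> * ln 80" using n_div by (simp add: add_divide_distrib)
    finally show ?thesis using 1 unfolding norm_H[OF w] by simp
  qed
  moreover have "exp (1 - ln 8 / ln T - \<epsilon> * ln 80) * norm (H (- (3 / 2))) \<le> norm (H (- (7 / 2)))"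
  proof -
    have z1: "c + - (3 / 2) = Complex (3 / 2) T" and z2: "c + - (7 / 2) = Complex (- (1 / 2)) T"
      by (simp_all add: c_def complex_eq_iff)
    have w: "- (3 / 2) \<in> ball (0::complex) (37 / 10)"
      "- (7 / 2) \<in> ball (0::complex) (37 / 10)" by (auto simp: norm_divide)
    define u v where "u = Complex (3 / 2) T" and "v = Complex (- (1 / 2)) T"
    have uv1: "u \<noteq> 1" "v \<noteq> 1" by (auto simp: u_def v_def complex_eq_iff)
    have v4: "v \<in> cball c 4"
      using w(2) unfolding v_def z2[symmetric] by (simp add: dist_norm norm_divide)
    have pos: "norm (G u) > 0" "norm (G v) > 0"
      using G_pos[OF w(1)] G_pos[OF w(2)] unfolding z1 z2 u_def v_def by auto
    have "norm (G u) * (1 / 80) ^ n \<le> norm (G u) * norm (P u)"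
      using P_ge_right[of u] by (intro mult_left_mono) (auto simp: u_def)
    also have "\<dots> = norm (zeta u)" using G[OF uv1(1)] by (simp add: norm_mult)
    finally have 1: "norm (G u) * (1 / 80) ^ n \<le> norm (zeta u)" .
    \<comment> \<open>The crude \<open>2 * pi < 8\<close> costs only \<open>ln 8 / ln T\<close> in
      the exponent. Below, \<open>P\<close> is bounded from below at \<open>u\<close> and by 1 at
      \<open>v\<close>, the directions that preserve the growth from \<open>u\<close> to
      \<open>v\<close>.\<close>
    have "T / 8 \<le> norm v / (2 * pi)"
      using abs_Im_le_cmod[of v] T pi_less_4 by (intro frac_le) (auto simp: v_def)
    then have "T / 8 * (norm (G u) * (1 / 80) ^ n) \<le> norm v / (2 * pi) * norm (zeta u)"
      using 1 T by (intro mult_mono) auto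
    also have "\<dots> = norm (zeta v)" unfolding u_def v_def by (rule norm_zeta_minus_half[symmetric])
    also have "\<dots> = norm (G v) * norm (P v)" using G[OF uv1(2)] by (simp add: norm_mult)
    also have "\<dots> \<le> norm (G v) * 1" using P_le[OF v4] by (intro mult_left_mono) auto
    finally have "T * norm (G u) \<le> 8 * norm (G v) * 80 ^ n" by (simp add: power_divide field_simps)
    then have "ln (T * norm (G u)) \<le> ln (8 * norm (G v) * 80 ^ n)"
      using T pos by (intro ln_mono) auto
    then have "ln T + ln (norm (G u)) \<le> ln 8 + ln (norm (G v)) + real n * ln 80"
      using T pos by (subst (asm) ln80) (auto simp: ln_mult)
    then have "(ln T + ln (norm (G u)) - ln 8 - real n * ln 80) / ln T \<le> ln (norm (G v)) / ln T"
      using lnT by (intro divide_right_mono) auto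
    moreover have "(ln T + ln (norm (G u)) - ln 8 - real n * ln 80) / ln T =
        1 + ln (norm (G u)) / ln T - ln 8 / ln T - real n * ln 80 / ln T"
      using lnT by (simp add: diff_divide_distrib add_divide_distrib)
    ultimately have "(1 - ln 8 / ln T - \<epsilon> * ln 80) + ln (norm (G u)) / ln T \<le> ln (norm (G v)) / ln T"
      using n_div by linarith
    then show ?thesis
      unfolding norm_H[OF w(1)] norm_H[OF w(2)] z1 z2 u_def[symmetric] v_def[symmetric]
      by (simp flip: exp_add)
  qed
  ultimately show ?thesis by blast
qed

section \<open>Small gaps\<close>

theorem corollary1p6:
  fixes B :: real
  assumes "B > 4"
    and "\<And>\<sigma>. \<sigma> > 1 / 2 \<Longrightarrow>
      (\<lambda>T. real (zero_density \<sigma> T)) \<in> O[at_top](\<lambda>T. T powr (2 * (1 - \<sigma>)) * ln T powr (- B))"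
  shows "\<exists>lam::real. \<exists>\<^sub>\<infinity>n. ordinate (Suc n) - ordinate n < lam * average_gap (ordinate n)"
proof (rule ccontr)
  assume contra: "\<not> ?thesis"
  have gaps: "\<forall>\<^sub>F n in sequentially. lam * average_gap (ordinate n) \<le> ordinate (Suc n) - ordinate n" for lam
    using contra by (simp add: not_INFM not_less cofinite_eq_sequentially frequently_def)
  obtain C0 where C0: "\<And>s. Re s \<ge> - (9 / 10) \<Longrightarrow> norm (s - 1) \<ge> 1 \<Longrightarrow> norm (zeta s) \<le> C0 * (1 + norm s) ^ 2"
    using zeta_polynomial_bound[of "- (9 / 10)"] by auto
  \<comment> \<open>\<open>C \<ge> 1\<close> makes \<open>ln C\<close> nonnegative, so that
    \<open>ln C / ln T\<close> is at most \<open>ln C\<close> whatever \<open>T\<close> is.\<close>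
  define C where "C = max 1 C0"
  have C: "norm (zeta s) \<le> C * (1 + norm s) ^ 2" if "Re s \<ge> - (9 / 10)" "norm (s - 1) \<ge> 1" for s
    by (rule order_trans[OF C0[OF that] mult_right_mono]) (auto simp: C_def)
  define \<epsilon> :: "nat \<Rightarrow> real" where "\<epsilon> = (\<lambda>k. 1 / real (Suc k))"
  define spec where "spec = (\<lambda>k T H. T \<ge> real k \<and> T \<ge> 20 \<and> H holomorphic_on ball 0 (37 / 10) \<and>
    (\<forall>w\<in>ball 0 (37 / 10). norm (H w) \<le> exp (ln C + 3 + ln 80)) \<and>
    (\<forall>w\<in>ball 0 1. exp (- ln 4 / ln T) \<le> norm (H w) \<and> norm (H w) \<le> exp (ln 2 / ln T + \<epsilon> k * ln 80)) \<and>
    exp (1 - ln 8 / ln T - \<epsilon> k * ln 80) * norm (H (- (3 / 2))) \<le> norm (H (- (7 / 2))))"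
  have "\<exists>T H. spec k T H" for k
  proof -
    have "\<forall>\<^sub>F a in at_top. real (zero_count (a + 8)) - real (zero_count a) \<le> \<epsilon> k * ln a"
      by (rule zeros_in_window_if_gaps_large[OF gaps]) (simp add: \<epsilon>_def)
    then obtain a0 where a0: "\<And>a. a \<ge> a0 \<Longrightarrow> real (zero_count (a + 8)) - real (zero_count a) \<le> \<epsilon> k * ln a"
      unfolding eventually_at_top_linorder by blast
    \<comment> \<open>The window of length 8 around \<open>T\<close> begins at \<open>T - 4\<close>,
      which has to be at least \<open>a0\<close>.\<close>
    obtain T where T: "T \<ge> max (a0 + 4) (max (real k) 20)"
      and free: "\<And>\<rho>. \<rho> \<noteq> 1 \<Longrightarrow> zeta \<rho> = 0 \<Longrightarrow> 9 / 10 < Re \<rho> \<Longrightarrow> \<bar>\<bar>Im \<rho>\<bar> - T\<bar> \<ge> 4"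
      using unbounded_zero_free_windows[OF _ assms(2)[of "9 / 10"], of "max (a0 + 4) (max (real k) 20)"] assms(1)
      by auto
    have "real (zero_count (T + 4)) - real (zero_count (T - 4)) \<le> \<epsilon> k * ln (T - 4)"
      using a0[of "T - 4"] T by (simp add: add.commute)
    also have "\<dots> \<le> \<epsilon> k * ln T" using T by (intro mult_left_mono ln_mono) (auto simp: \<epsilon>_def)
    finally have count: "real (zero_count (T + 4)) - real (zero_count (T - 4)) \<le> \<epsilon> k * ln T" .
    have T': "T \<ge> real k" "T \<ge> 20" using T by auto
    have "\<exists>H. H holomorphic_on ball 0 (37 / 10) \<and>
      (\<forall>w\<in>ball 0 (37 / 10). norm (H w) \<le> exp (ln C + 3 + ln 80)) \<and>
      (\<forall>w\<in>ball 0 1. exp (- ln 4 / ln T) \<le> norm (H w) \<and> norm (H w) \<le> exp (ln 2 / ln T + \<epsilon> k * ln 80)) \<and>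
      exp (1 - ln 8 / ln T - \<epsilon> k * ln 80) * norm (H (- (3 / 2))) \<le> norm (H (- (7 / 2)))"
      by (rule zeta_local_normalization[OF _ C T'(2) free count]) (auto simp: C_def \<epsilon>_def)
    then obtain H where H: "H holomorphic_on ball 0 (37 / 10) \<and>
      (\<forall>w\<in>ball 0 (37 / 10). norm (H w) \<le> exp (ln C + 3 + ln 80)) \<and>
      (\<forall>w\<in>ball 0 1. exp (- ln 4 / ln T) \<le> norm (H w) \<and> norm (H w) \<le> exp (ln 2 / ln T + \<epsilon> k * ln 80)) \<and>
      exp (1 - ln 8 / ln T - \<epsilon> k * ln 80) * norm (H (- (3 / 2))) \<le> norm (H (- (7 / 2)))" ..
    have "spec k T H"
      unfolding spec_def by (rule conjI[OF T'(1) conjI[OF T'(2) H]])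
    then show ?thesis by blast
  qed
  then obtain T H where "\<And>k. spec k (T k) (H k)" by metis
  then have T: "\<And>k. T k \<ge> real k" "\<And>k. T k \<ge> 20"
    and H: "\<And>k. H k holomorphic_on ball 0 (37 / 10)"
      "\<And>k w. w \<in> ball 0 (37 / 10) \<Longrightarrow> norm (H k w) \<le> exp (ln C + 3 + ln 80)"
      "\<And>k w. w \<in> ball 0 1 \<Longrightarrow> exp (- ln 4 / ln (T k)) \<le> norm (H k w)"
      "\<And>k w. w \<in> ball 0 1 \<Longrightarrow> norm (H k w) \<le> exp (ln 2 / ln (T k) + \<epsilon> k * ln 80)"
      "\<And>k. exp (1 - ln 8 / ln (T k) - \<epsilon> k * ln 80) * norm (H k (- (3 / 2))) \<le> norm (H k (- (7 / 2)))"
    unfolding spec_def by blast+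
  have "filterlim T at_top sequentially"
    by (rule filterlim_at_top_mono[OF filterlim_real_sequentially]) (use T in auto)
  then have "filterlim (\<lambda>k. ln (T k)) at_infinity sequentially"
    by (intro filterlim_at_top_imp_at_infinity filterlim_compose[OF ln_at_top])
  then have lim_div: "(\<lambda>k. b / ln (T k)) \<longlonglongrightarrow> 0" for b :: real
    by (rule tendsto_divide_0[OF tendsto_const])
  have lim_\<epsilon>: "(\<lambda>k. \<epsilon> k * ln 80) \<longlonglongrightarrow> 0"
    unfolding \<epsilon>_def by real_asymp
  obtain \<phi> where \<phi>: "strict_mono \<phi>" "\<And>w. w \<in> ball 0 (37 / 10) \<Longrightarrow> (\<lambda>k. norm (H (\<phi> k) w)) \<longlonglongrightarrow> 1"
  proof (rule montel_unimodular[of 1 "37 / 10" H "exp (ln C + 3 + ln 80)"])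
    fix w :: complex assume w: "w \<in> ball 0 1"
    show "(\<lambda>k. norm (H k w)) \<longlonglongrightarrow> 1"
    proof (rule tendsto_sandwich)
      show "\<forall>\<^sub>F k in sequentially. exp (- ln 4 / ln (T k)) \<le> norm (H k w)"
        "\<forall>\<^sub>F k in sequentially. norm (H k w) \<le> exp (ln 2 / ln (T k) + \<epsilon> k * ln 80)"
        using H(3,4)[OF w] by auto
      show "(\<lambda>k. exp (- ln 4 / ln (T k))) \<longlonglongrightarrow> 1"
        using tendsto_exp[OF lim_div[of "- ln 4"]] by simp
      show "(\<lambda>k. exp (ln 2 / ln (T k) + \<epsilon> k * ln 80)) \<longlonglongrightarrow> 1"
        using tendsto_exp[OF tendsto_add[OF lim_div[of "ln 2"] lim_\<epsilon>]] by simp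
    qed
  qed (use H in auto)
  have "(\<lambda>k. exp (1 - ln 8 / ln (T k) - \<epsilon> k * ln 80)) \<longlonglongrightarrow> exp (1 - 0 - 0)"
    by (intro tendsto_exp tendsto_diff tendsto_const lim_div lim_\<epsilon>)
  from LIMSEQ_subseq_LIMSEQ[OF this \<phi>(1)]
  have e: "(\<lambda>k. exp (1 - ln 8 / ln (T (\<phi> k)) - \<epsilon> (\<phi> k) * ln 80)) \<longlonglongrightarrow> exp 1" by (simp add: o_def)
  \<comment> \<open>Seen from the centre, \<open>- (3 / 2)\<close> and \<open>- (7 / 2)\<close> are
    the points 3/2 + \<i> T and -1/2 + \<i> T that the functional equation connects; both moduli
    tend to 1.\<close>
  have "exp 1 * 1 \<le> (1::real)"
  proof (rule LIMSEQ_le)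
    show "(\<lambda>k. exp (1 - ln 8 / ln (T (\<phi> k)) - \<epsilon> (\<phi> k) * ln 80) * norm (H (\<phi> k) (- (3 / 2)))) \<longlonglongrightarrow> exp 1 * 1"
      by (intro tendsto_mult e \<phi>(2)) (simp add: norm_divide)
    show "(\<lambda>k. norm (H (\<phi> k) (- (7 / 2)))) \<longlonglongrightarrow> 1"
      by (rule \<phi>(2)) (simp add: norm_divide)
  qed (use H(5) in auto)
  then show False by simp
qed

end
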